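(* Let $p$ be a prime and let $G$ be a non-abelian group of order $p^n$ and nilpotency class $c$, with $|\gamma_2(G)| = p^k$ and $d(G) = d$. Then $$|M(G)| \leq p^{\frac{1}{2}(d-1)(n+k)-\sum_{i=2}^{\min(d,c)} (d-i)}.$$
   Context: For a group $G$, $\gamma_2(G)$ denotes the commutator subgroup of $G$, $d(G)$ denotes the minimal number of generators of $G$, and $M(G)$ denotes the Schur multiplier of $G$ (that is, $M(G) \cong H_2(G,\mathbb{Z})$). *)

theory Defs
  imports Complex_Main "HOL-Algebra.Algebra" "HOL-Computational_Algebra.Primes"
begin

text \<open>
  The Schur multiplier is rendered as the second integral homology group, computed from the
  inhomogeneous (unnormalised) bar complex with trivial integer coefficients: in degree \<open>n\<close> it
  is free abelian on the \<open>n\<close>-tuples of group elements, and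
    \<open>d\<^sub>2 [g|h] = [h] - [gh] + [g]\<close>,
    \<open>d\<^sub>3 [g|h|k] = [h|k] - [gh|k] + [g|hk] - [g|h]\<close>.
\<close>

definition bar_chain1 :: "('a, 'b) monoid_scheme \<Rightarrow> ('a \<Rightarrow>\<^sub>0 int) monoid"
  where "bar_chain1 G = free_Abelian_group (carrier G)"

definition bar_chain2 :: "('a, 'b) monoid_scheme \<Rightarrow> ('a \<times> 'a \<Rightarrow>\<^sub>0 int) monoid"
  where "bar_chain2 G = free_Abelian_group (carrier G \<times> carrier G)"

definition bar_chain3 :: "('a, 'b) monoid_scheme \<Rightarrow> ('a \<times> 'a \<times> 'a \<Rightarrow>\<^sub>0 int) monoid"
  where "bar_chain3 G = free_Abelian_group (carrier G \<times> carrier G \<times> carrier G)"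

definition bar_boundary2 ::
    "('a, 'b) monoid_scheme \<Rightarrow> ('a \<times> 'a \<Rightarrow>\<^sub>0 int) \<Rightarrow> ('a \<Rightarrow>\<^sub>0 int)"
  where "bar_boundary2 G =
    frag_extend (\<lambda>(g, h). frag_of h - frag_of (g \<otimes>\<^bsub>G\<^esub> h) + frag_of g)"

definition bar_boundary3 ::
    "('a, 'b) monoid_scheme \<Rightarrow> ('a \<times> 'a \<times> 'a \<Rightarrow>\<^sub>0 int) \<Rightarrow> ('a \<times> 'a \<Rightarrow>\<^sub>0 int)"
  where "bar_boundary3 G =
    frag_extend (\<lambda>(g, h, k). frag_of (h, k) - frag_of (g \<otimes>\<^bsub>G\<^esub> h, k)
                           + frag_of (g, h \<otimes>\<^bsub>G\<^esub> k) - frag_of (g, h))"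

definition schur_multiplier :: "('a, 'b) monoid_scheme \<Rightarrow> ('a \<times> 'a \<Rightarrow>\<^sub>0 int) set monoid"
  where "schur_multiplier G =
    (bar_chain2 G)\<lparr>carrier := kernel (bar_chain2 G) (bar_chain1 G) (bar_boundary2 G)\<rparr>
      Mod (bar_boundary3 G ` carrier (bar_chain3 G))"

text \<open>Index shift: \<open>lower_central G i\<close> is the term \<open>\<gamma>\<close> with index \<open>i + 1\<close> of the lower central
  series, so that \<open>G\<close> has class \<open>c\<close> iff \<open>c\<close> is least with \<open>lower_central G c\<close> trivial.\<close>

primrec lower_central :: "('a, 'b) monoid_scheme \<Rightarrow> nat \<Rightarrow> 'a set"
  where
    "lower_central G 0 = carrier G"
  | "lower_central G (Suc i) = generate G
       (\<Union>x \<in> lower_central G i. \<Union>g \<in> carrier G. {x \<otimes>\<^bsub>G\<^esub> g \<otimes>\<^bsub>G\<^esub> inv\<^bsub>G\<^esub> x \<otimes>\<^bsub>G\<^esub> inv\<^bsub>G\<^esub> g})"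

lemma lower_central_1: "lower_central G (Suc 0) = derived G (carrier G)"
  by (simp add: derived_def)

definition has_nilpotency_class :: "('a, 'b) monoid_scheme \<Rightarrow> nat \<Rightarrow> bool"
  where "has_nilpotency_class G c \<longleftrightarrow>
    lower_central G c = {\<one>\<^bsub>G\<^esub>} \<and> (\<forall>i<c. lower_central G i \<noteq> {\<one>\<^bsub>G\<^esub>})"

text \<open>Meaningful for finitely generated \<open>G\<close> only.\<close>

definition min_generators :: "('a, 'b) monoid_scheme \<Rightarrow> nat"
  where "min_generators G =
    (LEAST m. \<exists>S \<subseteq> carrier G. finite S \<and> card S = m \<and> generate G S = carrier G)"

end

theory Submission
  imports Defs
begin

text \<open>
  Let \<open>A\<close> be the group of bar 2-chains of \<open>G\<close> modulo boundaries. The symbols \<open>[g|h]\<close> form a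
  2-cocycle with values in \<open>A\<close>, hence a central extension \<open>E\<close> of \<open>G\<close> by \<open>A\<close>, and a chain \<open>z\<close> that is a
  cycle lies, as an element of \<open>E\<close>, in the derived subgroup: the lifts \<open>s g\<close> of the elements of \<open>G\<close>
  satisfy \<open>s g \<cdot> s h = [g|h] \<cdot> s (gh)\<close>, so that modulo the derived subgroup \<open>z\<close> becomes the image of
  its boundary (\<open>cycle_in_derived\<close>). Hence \<open>|M(G)| \<cdot> |\<gamma>\<^sub>2(G)| \<le> |\<gamma>\<^sub>2(E)|\<close>
  (\<open>card_central_mult_card_derived_le\<close>), and the claim becomes a bound on the derived subgroup of an
  arbitrary central extension \<open>E\<close> of the \<open>p\<close>-group \<open>G\<close> (\<open>card_derived_le\<close>). It is obtained by
  going down the lower central series of \<open>E\<close>, which has length at most \<open>c + 1\<close>. Fix lifts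
  \<open>x\<^sub>1, \<dots>, x\<^sub>d\<close> of generators of \<open>G\<close>.

  The factor \<open>\<gamma>\<^sub>2(E)/\<gamma>\<^sub>3(E)\<close> is generated by the commutators \<open>[x\<^sub>i, x\<^sub>j]\<close> and is a quotient of
  the exterior square of \<open>G/\<gamma>\<^sub>2(G)\<close>. Remove from the generators the one whose index over the subgroup spanned
  by the others is the smallest, say \<open>m\<close>. Modulo the commutators of the others, commuting with it is a
  homomorphism from the span of the others that kills \<open>m\<close>-th powers, so it contributes at most \<open>m\<^bsup>d-1\<^esup>\<close>, while the others span a group of
  order at least \<open>m\<^bsup>d-1\<^esup>\<close>. By induction the square of the order of the factor is at most
  \<open>|G/\<gamma>\<^sub>2(G)|\<^bsup>d-1\<^esup>\<close> (\<open>mutual_commutators_covered\<close>).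

  For \<open>2 \<le> i \<le> c\<close> put \<open>V = \<gamma>\<^sub>i(G)/\<gamma>\<^sub>i\<^sub>+\<^sub>1(G)\<close>. The factor \<open>\<gamma>\<^sub>i\<^sub>+\<^sub>1(E)/\<gamma>\<^sub>i\<^sub>+\<^sub>2(E)\<close> is the sum of the images
  of the \<open>d\<close> homomorphisms \<open>u \<mapsto> [u, x\<^sub>j]\<close> on \<open>V\<close>, so its order is at most \<open>|V|\<^sup>d\<close>. For \<open>i \<le> d\<close> a
  factor \<open>p\<^bsup>d-i\<^esup>\<close> can be saved: some left-normed commutator \<open>u\<close> of weight \<open>i\<close> in the generators is nontrivial in \<open>V\<close>. If
  \<open>J\<close> is the set of at most \<open>i\<close> generators that occur in \<open>u\<close>, the Jacobi identity writes
  \<open>[u, x\<^sub>z]\<close> in terms of commutators \<open>[v, x\<^sub>j]\<close> with \<open>x\<^sub>j\<close> in \<open>J\<close> (\<open>commutator_left_normed_mem\<close>). Once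
  the images that belong to \<open>J\<close> are divided out, each of the other \<open>d - i\<close> or more homomorphisms has
  the nontrivial element \<open>u\<close> in its kernel, and its image has order at most \<open>|V|/p\<close>
  (\<open>higher_layer_covered\<close>).

  Multiplying up, \<open>|\<gamma>\<^sub>2(E)|\<close> is at most \<open>p\<close> to the power
  \<open>(d-1)(n-k)/2 + dk - (\<Sum>i=2..min d c. d-i)\<close>, and dividing by \<open>|\<gamma>\<^sub>2(G)| = p\<^sup>k\<close> gives the theorem.
\<close>

section \<open>Commutators\<close>

(* Unfolded terms of the series would no longer match the lemmas about them. *)
declare lower_central.simps(2) [simp del]

definition commutator :: "('a, 'b) monoid_scheme \<Rightarrow> 'a \<Rightarrow> 'a \<Rightarrow> 'a"
  where "commutator G x y = x \<otimes>\<^bsub>G\<^esub> y \<otimes>\<^bsub>G\<^esub> inv\<^bsub>G\<^esub> x \<otimes>\<^bsub>G\<^esub> inv\<^bsub>G\<^esub> y"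

context group
begin

text \<open>Together with associativity and the rule for inverses of products, these two rules rewrite every word
  to its reduced form, so that identities between words hold by simplification.\<close>

lemma cancel_inv_left:
  assumes "a \<in> carrier G" "b \<in> carrier G"
  shows "inv a \<otimes> (a \<otimes> b) = b" and "a \<otimes> (inv a \<otimes> b) = b"
  using assms by (simp_all flip: m_assoc)

lemmas group_word_simps = m_assoc inv_mult_group cancel_inv_left

lemma commutator_closed [simp, intro]:
  "x \<in> carrier G \<Longrightarrow> y \<in> carrier G \<Longrightarrow> commutator G x y \<in> carrier G"
  by (simp add: commutator_def)

lemma commutator_one_left [simp]: "x \<in> carrier G \<Longrightarrow> commutator G \<one> x = \<one>"
  by (simp add: commutator_def)

lemma inv_commutator:
  "x \<in> carrier G \<Longrightarrow> y \<in> carrier G \<Longrightarrow> inv (commutator G x y) = commutator G y x"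
  by (simp add: commutator_def group_word_simps)

lemma conj_eq_commutator_mult:
  "x \<in> carrier G \<Longrightarrow> y \<in> carrier G \<Longrightarrow> x \<otimes> y \<otimes> inv x = commutator G x y \<otimes> y"
  by (simp add: commutator_def group_word_simps)

lemma commutator_mult_left:
  "\<lbrakk>a \<in> carrier G; b \<in> carrier G; x \<in> carrier G\<rbrakk> \<Longrightarrow>
    commutator G (a \<otimes> b) x = (a \<otimes> commutator G b x \<otimes> inv a) \<otimes> commutator G a x"
  by (simp add: commutator_def group_word_simps)

lemma commutator_eq_one_iff:
  assumes "x \<in> carrier G" "y \<in> carrier G"
  shows "commutator G x y = \<one> \<longleftrightarrow> x \<otimes> y = y \<otimes> x"
proof
  assume "commutator G x y = \<one>"
  then have "commutator G x y \<otimes> (y \<otimes> x) = y \<otimes> x" using assms by simp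
  then show "x \<otimes> y = y \<otimes> x" using assms by (simp add: commutator_def group_word_simps)
next
  assume "x \<otimes> y = y \<otimes> x"
  then show "commutator G x y = \<one>" using assms by (simp add: commutator_def group_word_simps(1))
qed

end

lemma (in group_hom) hom_commutator:
  "x \<in> carrier G \<Longrightarrow> y \<in> carrier G \<Longrightarrow> h (commutator G x y) = commutator H (h x) (h y)"
  by (simp add: commutator_def)

lemma (in group_hom) subgroup_of_preimage:
  assumes "subgroup I H" shows "subgroup {x \<in> carrier G. h x \<in> I} G"
proof -
  interpret I: subgroup I H by (rule assms)
  show ?thesis by (rule G.subgroupI) auto
qed

section \<open>Commutators modulo a normal subgroup\<close>

text \<open>For normal \<open>S\<close> this is the preimage of the centralizer of the image of \<open>B\<close> modulo \<open>S\<close>.\<close>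

definition centralizer_mod :: "('a, 'b) monoid_scheme \<Rightarrow> 'a set \<Rightarrow> 'a set \<Rightarrow> 'a set"
  where "centralizer_mod G S B = {a \<in> carrier G. \<forall>b\<in>B. commutator G a b \<in> S}"

context normal
begin

lemma group_hom_quotient: "group_hom G (G Mod H) ((#>) H)"
  by (simp add: group_hom_axioms_def group_hom_def is_group factorgroup_is_group r_coset_hom_Mod)

lemma coset_eq_iff:
  assumes "x \<in> carrier G" "y \<in> carrier G"
  shows "H #> x = H #> y \<longleftrightarrow> x \<in> H #> y"
  using assms rcos_self repr_independence subgroup_axioms by metis

lemma coset_eq_self_iff: "x \<in> carrier G \<Longrightarrow> H #> x = H \<longleftrightarrow> x \<in> H"
  by (metis coset_join1 coset_join2 is_group subgroup_axioms)

lemma commutator_mem_iff_commute_mod: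
  assumes "x \<in> carrier G" "y \<in> carrier G"
  shows "commutator G x y \<in> H \<longleftrightarrow>
    (H #> x) \<otimes>\<^bsub>G Mod H\<^esub> (H #> y) = (H #> y) \<otimes>\<^bsub>G Mod H\<^esub> (H #> x)"
proof -
  interpret q: group_hom G "G Mod H" "(#>) H" by (rule group_hom_quotient)
  have "commutator G x y \<in> H \<longleftrightarrow> H #> commutator G x y = \<one>\<^bsub>G Mod H\<^esub>"
    using assms by (simp add: coset_eq_self_iff)
  then show ?thesis
    using assms by (simp only: q.hom_commutator q.H.commutator_eq_one_iff q.hom_closed)
qed

lemma commutator_mem_swap:
  assumes "x \<in> carrier G" "y \<in> carrier G"
  shows "commutator G x y \<in> H \<longleftrightarrow> commutator G y x \<in> H"
  using assms by (metis commutator_mem_iff_commute_mod)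

lemma commutator_normal_left:
  assumes "h \<in> H" "x \<in> carrier G" shows "commutator G h x \<in> H"
proof -
  have h: "h \<in> carrier G" using assms(1) mem_carrier by blast
  have "commutator G h x = h \<otimes> (x \<otimes> inv h \<otimes> inv x)"
    using assms h by (simp add: commutator_def m_assoc)
  then show ?thesis using assms h inv_op_closed2 by simp
qed

text \<open>That this is a subgroup reduces claims about commutators with all elements of a generated subgroup
  to commutators with its generators; most arguments below have this form.\<close>

lemma subgroup_centralizer_mod:
  assumes "B \<subseteq> carrier G" shows "subgroup (centralizer_mod G H B) G"
proof (rule subgroupI)
  show "centralizer_mod G H B \<subseteq> carrier G" by (auto simp: centralizer_mod_def)
  have "\<one> \<in> centralizer_mod G H B" using assms by (auto simp: centralizer_mod_def)
  then show "centralizer_mod G H B \<noteq> {}" by blast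
next
  fix a assume a: "a \<in> centralizer_mod G H B"
  have "commutator G (inv a) b \<in> H" if b: "b \<in> B" for b
  proof -
    have ab: "a \<in> carrier G" "b \<in> carrier G" "commutator G a b \<in> H"
      using a b assms by (auto simp: centralizer_mod_def)
    have "commutator G (inv a) b = inv a \<otimes> inv (commutator G a b) \<otimes> a"
      using ab by (simp add: commutator_def group_word_simps)
    then show ?thesis using ab inv_op_closed1[of a "inv (commutator G a b)"] by simp
  qed
  then show "inv a \<in> centralizer_mod G H B" using a by (auto simp: centralizer_mod_def)
next
  fix a a' assume a: "a \<in> centralizer_mod G H B" "a' \<in> centralizer_mod G H B"
  have "commutator G (a \<otimes> a') b \<in> H" if b: "b \<in> B" for b
  proof -
    have ab: "a \<in> carrier G" "a' \<in> carrier G" "b \<in> carrier G" "commutator G a b \<in> H" "commutator G a' b \<in> H"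
      using a b assms by (auto simp: centralizer_mod_def)
    then show ?thesis using inv_op_closed2 by (simp add: commutator_mult_left)
  qed
  then show "a \<otimes> a' \<in> centralizer_mod G H B" using a by (auto simp: centralizer_mod_def)
qed

end

section \<open>Counting by covers with cosets\<close>

text \<open>An upper bound \<open>N\<close> for the index of \<open>S\<close> in \<open>K\<close>. As a statement about covers it needs neither a finite
  index nor a quotient group, so it applies to terms of the lower central series of an extension that
  are not yet known to be finite. The representatives are taken from \<open>K\<close> so that covers can be composed
  and transported along homomorphisms.\<close>

definition coset_covered :: "('a, 'b) monoid_scheme \<Rightarrow> 'a set \<Rightarrow> 'a set \<Rightarrow> nat \<Rightarrow> bool"
  where "coset_covered G K S N \<longleftrightarrow>
    (\<exists>T\<subseteq>K. finite T \<and> card T \<le> N \<and> K \<subseteq> S <#>\<^bsub>G\<^esub> T)"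

lemma coset_covered_mono: "coset_covered G K S N \<Longrightarrow> N \<le> M \<Longrightarrow> coset_covered G K S M"
  unfolding coset_covered_def by (meson order_trans)

context group
begin

lemma coset_covered_refl:
  assumes "subgroup K G" shows "coset_covered G K K 1"
  unfolding coset_covered_def
  by (rule exI[of _ "{\<one>}"])
     (use assms subgroup.subset[OF assms] in \<open>force simp: set_mult_def subgroup.one_closed\<close>)

lemma coset_covered_trans:
  assumes "subgroup K G" "S \<subseteq> K" "L \<subseteq> carrier G" "coset_covered G K S N" "coset_covered G S L M"
  shows "coset_covered G K L (N * M)"
proof -
  obtain T where T: "T \<subseteq> K" "finite T" "card T \<le> N" "K \<subseteq> S <#> T"
    using assms(4) by (auto simp: coset_covered_def)
  obtain T' where T': "T' \<subseteq> S" "finite T'" "card T' \<le> M" "S \<subseteq> L <#> T'"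
    using assms(5) by (auto simp: coset_covered_def)
  have KG: "K \<subseteq> carrier G" using assms(1) subgroup.subset by blast
  have eq: "T' <#> T = (\<lambda>(s, t). s \<otimes> t) ` (T' \<times> T)" by (auto simp: set_mult_def)
  have "K \<subseteq> (L <#> T') <#> T"
    using T(4) mono_set_mult[OF T'(4), of T T G] by blast
  also have "\<dots> = L <#> (T' <#> T)"
    using assms(2,3) KG T(1) T'(1) by (intro set_mult_assoc) auto
  finally have "K \<subseteq> L <#> (T' <#> T)" .
  moreover have "T' <#> T \<subseteq> K"
    using T(1) T'(1) assms(2) by (fastforce simp: set_mult_def intro: subgroup.m_closed[OF assms(1)])
  moreover have "finite (T' <#> T)" using T(2) T'(2) by (simp add: eq)
  moreover have "card (T' <#> T) \<le> N * M"
  proof -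
    have "card (T' <#> T) \<le> card (T' \<times> T)" unfolding eq by (rule card_image_le) (use T T' in auto)
    also have "\<dots> \<le> N * M" using T(3) T'(3) by (simp add: card_cartesian_product mult.commute mult_le_mono)
    finally show ?thesis .
  qed
  ultimately show ?thesis unfolding coset_covered_def by blast
qed

lemma coset_covered_one_imp_card_le:
  assumes "coset_covered G K {\<one>} N" "K \<subseteq> carrier G"
  shows "finite K" "card K \<le> N"
proof -
  obtain T where T: "T \<subseteq> K" "finite T" "card T \<le> N" "K \<subseteq> {\<one>} <#> T"
    using assms(1) by (auto simp: coset_covered_def)
  then have "T = K" using assms(2) by (force simp: set_mult_def)
  then show "finite K" "card K \<le> N" using T by auto
qed

end

section \<open>Commutators with a fixed element\<close>

text \<open>In the situation of the locale below this is the subgroup generated by \<open>S\<close> and all commutators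
  \<open>[k, x]\<close>, in a form that exhibits representatives modulo \<open>S\<close>.\<close>

definition commutator_span :: "('a, 'b) monoid_scheme \<Rightarrow> 'a set \<Rightarrow> 'a set \<Rightarrow> 'a \<Rightarrow> 'a set"
  where "commutator_span G S K x = S <#>\<^bsub>G\<^esub> (\<lambda>k. commutator G k x) ` K"

locale central_commutators = normal S G for S and G (structure) +
  fixes K :: "'a set" and x :: 'a
  assumes K: "subgroup K G"
    and x: "x \<in> carrier G"
    and central: "\<lbrakk>k \<in> K; g \<in> carrier G\<rbrakk> \<Longrightarrow> commutator G (commutator G k x) g \<in> S"
begin

lemma K_closed [simp]: "k \<in> K \<Longrightarrow> k \<in> carrier G" 
  by (rule subgroup.mem_carrier[OF K])

text \<open>In \<open>[k l, x] = k [l, x] k\<^sup>-\<^sup>1 [k, x]\<close> the conjugation disappears modulo \<open>S\<close> because \<open>[l, x]\<close> is central there.\<close>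

lemma commutator_hom:
  "(\<lambda>k. S #> commutator G k x) \<in> hom (G\<lparr>carrier := K\<rparr>) (G Mod S)"
proof (rule homI)
  interpret q: group_hom G "G Mod S" "(#>) S" by (rule group_hom_quotient)
  fix k assume "k \<in> carrier (G\<lparr>carrier := K\<rparr>)"
  then show "S #> commutator G k x \<in> carrier (G Mod S)" using x by (intro q.hom_closed) auto
next
  interpret q: group_hom G "G Mod S" "(#>) S" by (rule group_hom_quotient)
  fix k l assume "k \<in> carrier (G\<lparr>carrier := K\<rparr>)" "l \<in> carrier (G\<lparr>carrier := K\<rparr>)"
  then have kl: "k \<in> K" "l \<in> K" "k \<in> carrier G" "l \<in> carrier G" by auto
  let ?c = "commutator G k x" and ?d = "commutator G l x"
  have cd: "?c \<in> carrier G" "?d \<in> carrier G" using kl x by auto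
  note comm = central[THEN commutator_mem_iff_commute_mod[THEN iffD1, rotated 2]]
  have 1: "(S #> k) \<otimes>\<^bsub>G Mod S\<^esub> (S #> ?d) = (S #> ?d) \<otimes>\<^bsub>G Mod S\<^esub> (S #> k)"
    using comm[OF kl(2) kl(3) cd(2) kl(3)] by simp
  have 2: "(S #> ?c) \<otimes>\<^bsub>G Mod S\<^esub> (S #> ?d) = (S #> ?d) \<otimes>\<^bsub>G Mod S\<^esub> (S #> ?c)"
    using comm[OF kl(2) cd(1) cd(2) cd(1)] by simp
  have Sk: "S #> k \<in> carrier (G Mod S)" "S #> ?d \<in> carrier (G Mod S)" "S #> ?c \<in> carrier (G Mod S)"
    using q.hom_closed kl cd by auto
  have "S #> commutator G (k \<otimes> l) x
      = ((S #> k) \<otimes>\<^bsub>G Mod S\<^esub> (S #> ?d) \<otimes>\<^bsub>G Mod S\<^esub> inv\<^bsub>G Mod S\<^esub> (S #> k)) \<otimes>\<^bsub>G Mod S\<^esub> (S #> ?c)"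
    using kl cd x by (simp only: commutator_mult_left q.hom_mult q.hom_inv m_closed inv_closed)
  also have "\<dots> = (S #> ?c) \<otimes>\<^bsub>G Mod S\<^esub> (S #> ?d)"
    unfolding 2
    using q.H.inv_solve_right[OF Sk(2) q.H.m_closed[OF Sk(1,2)] Sk(1), THEN iffD2, OF 1, symmetric]
    by (simp only:)
  finally show "S #> commutator G (k \<otimes>\<^bsub>G\<lparr>carrier := K\<rparr>\<^esub> l) x
      = (S #> ?c) \<otimes>\<^bsub>G Mod S\<^esub> (S #> ?d)" by (simp del: mult_FactGroup)
qed

lemma commutator_group_hom:
  "group_hom (G\<lparr>carrier := K\<rparr>) (G Mod S) (\<lambda>k. S #> commutator G k x)"
  by (simp add: K commutator_hom factorgroup_is_group group_hom_axioms_def group_hom_def subgroup_imp_group)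

lemma mem_commutator_span:
  "e \<in> commutator_span G S K x \<longleftrightarrow> (\<exists>k\<in>K. e \<in> S #> commutator G k x)"
  by (auto simp: commutator_span_def set_mult_def r_coset_def)

lemma mem_commutator_span':
  "e \<in> commutator_span G S K x \<longleftrightarrow> e \<in> carrier G \<and> (\<exists>k\<in>K. S #> e = S #> commutator G k x)"
  unfolding mem_commutator_span using x
  by (meson K_closed commutator_closed coset_eq_iff elemrcos_carrier is_group)

lemma subgroup_commutator_span: "subgroup (commutator_span G S K x) G"
proof -
  interpret q: group_hom G "G Mod S" "(#>) S" by (rule group_hom_quotient)
  interpret f: group_hom "G\<lparr>carrier := K\<rparr>" "G Mod S" "\<lambda>k. S #> commutator G k x"
    by (rule commutator_group_hom)
  have "commutator_span G S K x = {e \<in> carrier G. S #> e \<in> (\<lambda>k. S #> commutator G k x) ` K}"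
    using mem_commutator_span' by auto
  moreover have "subgroup ((\<lambda>k. S #> commutator G k x) ` K) (G Mod S)"
    using f.img_is_subgroup by simp
  ultimately show ?thesis using q.subgroup_of_preimage by simp
qed

lemma subset_commutator_span: "S \<subseteq> commutator_span G S K x"
proof
  fix s assume s: "s \<in> S"
  moreover have "\<one> \<in> K" using K subgroup.one_closed by blast
  moreover have "s \<in> S #> commutator G \<one> x"
    using s x coset_mult_one subset by simp
  ultimately show "s \<in> commutator_span G S K x" using mem_commutator_span by blast
qed

lemma commutator_in_span: "k \<in> K \<Longrightarrow> commutator G k x \<in> commutator_span G S K x"
  using mem_commutator_span' x by auto

lemma subgroup_kernel_commutator: "subgroup {k \<in> K. commutator G k x \<in> S} G"
proof -
  have "{k \<in> K. commutator G k x \<in> S} = K \<inter> centralizer_mod G S {x}"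
    by (auto simp: centralizer_mod_def)
  then show ?thesis using subgroup_centralizer_mod[of "{x}"] K x subgroups_Inter_pair by auto
qed

text \<open>The image of the homomorphism \<open>k \<mapsto> [k, x]\<close> is no larger than the index of its kernel.\<close>

lemma commutator_span_covered:
  assumes "coset_covered G K {k \<in> K. commutator G k x \<in> S} N"
  shows "coset_covered G (commutator_span G S K x) S N"
proof -
  interpret f: group_hom "G\<lparr>carrier := K\<rparr>" "G Mod S" "\<lambda>k. S #> commutator G k x"
    by (rule commutator_group_hom)
  obtain T where T: "T \<subseteq> K" "finite T" "card T \<le> N" "K \<subseteq> {k \<in> K. commutator G k x \<in> S} <#> T"
    using assms by (auto simp: coset_covered_def)
  let ?U = "(\<lambda>t. commutator G t x) ` T"
  have "commutator_span G S K x \<subseteq> S <#> ?U"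
  proof
    fix e assume "e \<in> commutator_span G S K x"
    then obtain k where k: "k \<in> K" "e \<in> S #> commutator G k x" using mem_commutator_span by blast
    then obtain h t where ht: "h \<in> K" "commutator G h x \<in> S" "t \<in> T" "k = h \<otimes> t"
      using T(4) by (auto simp: set_mult_def)
    have "S #> commutator G k x = (S #> commutator G h x) \<otimes>\<^bsub>G Mod S\<^esub> (S #> commutator G t x)"
      using f.hom_mult[of h t] ht T(1) by auto
    also have "S #> commutator G h x = \<one>\<^bsub>G Mod S\<^esub>"
      using ht(2) by (metis coset_join2 is_group mem_carrier one_FactGroup subgroup_axioms)
    finally have "S #> commutator G k x = S #> commutator G t x"
      using f.hom_closed[of t] ht(3) T(1) f.H.l_one by auto
    then show "e \<in> S <#> ?U" using k(2) ht(3) by (auto simp: set_mult_def r_coset_def)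
  qed
  moreover have "?U \<subseteq> commutator_span G S K x" using T(1) commutator_in_span by blast
  moreover have "finite ?U" "card ?U \<le> N"
    using T(2,3) card_image_le[of T "\<lambda>t. commutator G t x"] by auto
  ultimately show ?thesis unfolding coset_covered_def by blast
qed

(* In instances whose K is defined by a condition on carrier elements the rule would be circular. *)
declare K_closed [simp del]

end

section \<open>The lower central series\<close>

context group
begin

lemma lower_central_Suc_eq:
  "lower_central G (Suc i) = generate G {commutator G x g |x g. x \<in> lower_central G i \<and> g \<in> carrier G}"
  unfolding lower_central.simps(2) by (rule arg_cong[of _ _ "generate G"]) (auto simp: commutator_def)

lemma lower_central_normal: "lower_central G i \<lhd> G"
proof (induction i)
  case 0 show ?case by (simp add: normal_self)
next
  case (Suc i)
  then interpret L: normal "lower_central G i" G .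
  show ?case unfolding lower_central_Suc_eq
  proof (rule normal_generateI)
    show "{commutator G x g |x g. x \<in> lower_central G i \<and> g \<in> carrier G} \<subseteq> carrier G"
      using L.subset by auto
  next
    fix h g assume "h \<in> {commutator G x g |x g. x \<in> lower_central G i \<and> g \<in> carrier G}" and g: "g \<in> carrier G"
    then obtain x y where xy: "h = commutator G x y" "x \<in> lower_central G i" "y \<in> carrier G" by auto
    have x: "x \<in> carrier G" using xy L.subset by auto
    have "g \<otimes> h \<otimes> inv g = commutator G (g \<otimes> x \<otimes> inv g) (g \<otimes> y \<otimes> inv g)"
      using x xy(3) g by (simp add: xy(1) commutator_def group_word_simps)
    moreover have "g \<otimes> x \<otimes> inv g \<in> lower_central G i" using L.inv_op_closed2 g xy(2) by blast
    moreover have "g \<otimes> y \<otimes> inv g \<in> carrier G" using g xy(3) by simp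
    ultimately show "g \<otimes> h \<otimes> inv g \<in> {commutator G x g |x g. x \<in> lower_central G i \<and> g \<in> carrier G}"
      by blast
  qed
qed

lemma subgroup_lower_central: "subgroup (lower_central G i) G"
  by (simp add: lower_central_normal normal_imp_subgroup)

lemma lower_central_closed: "x \<in> lower_central G i \<Longrightarrow> x \<in> carrier G"
  using subgroup_lower_central subgroup.mem_carrier by metis

lemma commutator_lower_central:
  "x \<in> lower_central G i \<Longrightarrow> g \<in> carrier G \<Longrightarrow> commutator G x g \<in> lower_central G (Suc i)"
  unfolding lower_central_Suc_eq by (blast intro: generate.incl)

lemma lower_central_Suc_minimal:
  assumes "subgroup H G" "\<And>x g. x \<in> lower_central G i \<Longrightarrow> g \<in> carrier G \<Longrightarrow> commutator G x g \<in> H"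
  shows "lower_central G (Suc i) \<subseteq> H"
  unfolding lower_central_Suc_eq using assms by (intro generate_subgroup_incl) auto

lemma lower_central_Suc_subset: "lower_central G (Suc i) \<subseteq> lower_central G i"
proof (rule lower_central_Suc_minimal[OF subgroup_lower_central])
  interpret L: normal "lower_central G i" G by (rule lower_central_normal)
  show "commutator G x g \<in> lower_central G i" if "x \<in> lower_central G i" "g \<in> carrier G" for x g
    using that by (rule L.commutator_normal_left)
qed

lemma lower_central_antimono: "i \<le> j \<Longrightarrow> lower_central G j \<subseteq> lower_central G i"
  by (induction rule: dec_induct) (use lower_central_Suc_subset in blast)+

text \<open>A conjugate of \<open>h\<close> differs from \<open>h\<close> by a commutator, which lies in the next term.\<close>

lemma normal_between_lower_central:
  assumes "subgroup H G" "lower_central G (Suc i) \<subseteq> H" "H \<subseteq> lower_central G i"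
  shows "H \<lhd> G"
proof (rule normal_invI[OF assms(1)])
  fix g h assume gh: "g \<in> carrier G" "h \<in> H"
  then have h: "h \<in> carrier G" using assms(1) subgroup.mem_carrier by metis
  have "commutator G h g \<in> H" using gh assms commutator_lower_central by blast
  then have "commutator G g h \<in> H" using inv_commutator[of h g] assms(1) gh(1) h subgroup.m_inv_closed by metis
  then show "g \<otimes> h \<otimes> inv g \<in> H" using gh h assms(1) by (simp add: conj_eq_commutator_mult subgroup.m_closed)
qed

text \<open>An elementwise form of the Hall-Witt identity. Write \<open>e = [u, y]\<close> and \<open>c = [u, g]\<close>. Conjugation by \<open>u\<close>
  sends \<open>[y, g]\<close> to \<open>[e y, c g]\<close>, and the four commutation relations are just enough to cancel \<open>e\<close> and \<open>c\<close>.\<close>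

lemma commutes_with_commutator:
  assumes [simp]: "u \<in> carrier G" "y \<in> carrier G" "g \<in> carrier G"
    and ec: "commutator G u y \<otimes> commutator G u g = commutator G u g \<otimes> commutator G u y"
    and eyg: "commutator G u y \<otimes> (y \<otimes> g \<otimes> inv y) = (y \<otimes> g \<otimes> inv y) \<otimes> commutator G u y"
    and cy: "commutator G u g \<otimes> y = y \<otimes> commutator G u g"
    and cgy: "commutator G u g \<otimes> (g \<otimes> inv y \<otimes> inv g) = (g \<otimes> inv y \<otimes> inv g) \<otimes> commutator G u g"
  shows "u \<otimes> commutator G y g = commutator G y g \<otimes> u"
proof -
  define e c where "e = commutator G u y" and "c = commutator G u g"
  have [simp]: "e \<in> carrier G" "c \<in> carrier G" by (auto simp: e_def c_def)
  have uy: "u \<otimes> y \<otimes> inv u = e \<otimes> y" and ug: "u \<otimes> g \<otimes> inv u = c \<otimes> g"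
    by (auto simp: e_def c_def conj_eq_commutator_mult)
  have "u \<otimes> commutator G y g \<otimes> inv u
      = (u \<otimes> y \<otimes> inv u) \<otimes> (u \<otimes> g \<otimes> inv u) \<otimes> inv (u \<otimes> y \<otimes> inv u) \<otimes> inv (u \<otimes> g \<otimes> inv u)"
    by (simp add: commutator_def group_word_simps)
  also have "\<dots> = e \<otimes> (y \<otimes> c) \<otimes> g \<otimes> inv y \<otimes> inv e \<otimes> inv g \<otimes> inv c"
    unfolding uy ug by (simp add: group_word_simps)
  also have "\<dots> = (e \<otimes> c) \<otimes> (y \<otimes> g \<otimes> inv y) \<otimes> inv e \<otimes> inv g \<otimes> inv c"
    unfolding cy[folded c_def, symmetric] by (simp add: group_word_simps)
  also have "\<dots> = c \<otimes> (e \<otimes> (y \<otimes> g \<otimes> inv y)) \<otimes> inv e \<otimes> inv g \<otimes> inv c"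
    unfolding ec[folded e_def c_def] by (simp add: group_word_simps)
  also have "\<dots> = (c \<otimes> y) \<otimes> (g \<otimes> inv y \<otimes> inv g) \<otimes> inv c"
    unfolding eyg[folded e_def] by (simp add: group_word_simps)
  also have "\<dots> = y \<otimes> (c \<otimes> (g \<otimes> inv y \<otimes> inv g)) \<otimes> inv c"
    unfolding cy[folded c_def] by (simp add: group_word_simps)
  also have "\<dots> = commutator G y g"
    unfolding cgy[folded c_def] by (simp add: group_word_simps commutator_def)
  finally have "u \<otimes> commutator G y g \<otimes> inv u \<otimes> u = commutator G y g \<otimes> u" by simp
  then show ?thesis by (simp add: m_assoc)
qed

end

lemma (in normal) commutator_commutator_mem:
  assumes c: "u \<in> carrier G" "y \<in> carrier G" "g \<in> carrier G"
    and "commutator G (commutator G u y) (commutator G u g) \<in> H"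
    and "commutator G (commutator G u y) (y \<otimes> g \<otimes> inv y) \<in> H"
    and "commutator G (commutator G u g) y \<in> H"
    and "commutator G (commutator G u g) (g \<otimes> inv y \<otimes> inv g) \<in> H"
  shows "commutator G u (commutator G y g) \<in> H"
proof -
  interpret q: group_hom G "G Mod H" "(#>) H" by (rule group_hom_quotient)
  have cl: "commutator G u y \<in> carrier G" "commutator G u g \<in> carrier G" "commutator G y g \<in> carrier G"
      "y \<otimes> g \<otimes> inv y \<in> carrier G" "g \<otimes> inv y \<otimes> inv g \<in> carrier G" "inv y \<in> carrier G" "inv g \<in> carrier G"
      "y \<otimes> g \<in> carrier G" "g \<otimes> inv y \<in> carrier G"
    using c by auto
  have qc: "H #> u \<in> carrier (G Mod H)" "H #> y \<in> carrier (G Mod H)" "H #> g \<in> carrier (G Mod H)"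
    using q.hom_closed c by auto
  note * = assms(4-7)
  note * = *[unfolded commutator_mem_iff_commute_mod[OF cl(1,2)] commutator_mem_iff_commute_mod[OF cl(1,4)] 
      commutator_mem_iff_commute_mod[OF cl(2) c(2)] commutator_mem_iff_commute_mod[OF cl(2,5)]]
  note * = *[unfolded q.hom_commutator[OF c(1,2)] q.hom_commutator[OF c(1,3)] q.hom_commutator[OF c(2,3)]
     q.hom_mult[OF cl(8,6)] q.hom_mult[OF cl(9,7)] q.hom_mult[OF c(2,3)] q.hom_mult[OF c(3) cl(6)] q.hom_inv[OF c(2)] q.hom_inv[OF c(3)]]
  show ?thesis
    unfolding commutator_mem_iff_commute_mod[OF c(1) cl(3)] q.hom_commutator[OF c(2,3)]
    by (rule q.H.commutes_with_commutator[OF qc *])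
qed

context group
begin

text \<open>Modulo the target term, every generator \<open>[z, g]\<close> of the next term of the series commutes with \<open>x\<close>: the
  induction hypothesis for \<open>[x, z]\<close> and for commutators of \<open>[x, g]\<close> provides the four relations of the
  preceding lemma.\<close>

lemma commutator_lower_central_add:
  "\<lbrakk>x \<in> lower_central G a; y \<in> lower_central G b\<rbrakk> \<Longrightarrow> commutator G x y \<in> lower_central G (Suc (a + b))"
proof (induction b arbitrary: a x y)
  case 0 then show ?case by (simp add: commutator_lower_central)
next
  case (Suc b)
  define N where "N = lower_central G (Suc (a + Suc b))"
  interpret N: normal N G unfolding N_def by (rule lower_central_normal)
  interpret Lb: normal "lower_central G b" G by (rule lower_central_normal)
  have x: "x \<in> carrier G" using Suc.prems(1) by (rule lower_central_closed)
  have "lower_central G (Suc b) \<subseteq> centralizer_mod G N {x}"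
  proof (rule lower_central_Suc_minimal)
    show "subgroup (centralizer_mod G N {x}) G" using x by (intro N.subgroup_centralizer_mod) auto
    fix z g assume zg: "z \<in> lower_central G b" "g \<in> carrier G"
    have z: "z \<in> carrier G" using zg(1) by (rule lower_central_closed)
    have xz: "commutator G x z \<in> lower_central G (Suc (a + b))" using Suc.IH Suc.prems(1) zg(1) .
    have xg: "commutator G x g \<in> lower_central G (Suc a)"
      using Suc.prems(1) zg(2) by (rule commutator_lower_central)
    have top: "commutator G (commutator G x z) h \<in> N" if "h \<in> carrier G" for h
      using commutator_lower_central[OF xz that] by (simp add: N_def)
    have low: "commutator G (commutator G x g) h \<in> N" if "h \<in> lower_central G b" for h
      using Suc.IH[OF xg that] by (simp add: N_def)
    have "commutator G x (commutator G z g) \<in> N"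
    proof (rule N.commutator_commutator_mem)
      show "commutator G (commutator G x z) (commutator G x g) \<in> N" using x zg by (intro top) auto
      show "commutator G (commutator G x z) (z \<otimes> g \<otimes> inv z) \<in> N" using z zg by (intro top) auto
      show "commutator G (commutator G x g) z \<in> N" using zg by (intro low)
      show "commutator G (commutator G x g) (g \<otimes> inv z \<otimes> inv g) \<in> N" 
        using zg by (intro low Lb.inv_op_closed2 Lb.m_inv_closed)
    qed (use x z zg in auto)
    then show "commutator G z g \<in> centralizer_mod G N {x}"
      using x z zg N.commutator_mem_swap[of x "commutator G z g"] by (simp add: centralizer_mod_def)
  qed
  then have "commutator G y x \<in> N" using Suc.prems(2) by (auto simp: centralizer_mod_def)
  then show ?case unfolding N_def[symmetric]
    using N.commutator_mem_swap[OF x lower_central_closed[OF Suc.prems(2)]] by blast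
qed

text \<open>The left fold \<open>foldl (commutator G) x [y\<^sub>1, \<dots>, y\<^sub>m]\<close> is the left-normed commutator
  \<open>[\<dots>[[x, y\<^sub>1], y\<^sub>2], \<dots>, y\<^sub>m]\<close> of weight \<open>m + 1\<close>.\<close>

lemma left_normed_in_lower_central:
  "\<lbrakk>x \<in> carrier G; set ys \<subseteq> carrier G\<rbrakk> \<Longrightarrow> foldl (commutator G) x ys \<in> lower_central G (length ys)"
  by (induction ys rule: rev_induct) (simp_all add: commutator_lower_central)

lemma left_normed_closed:
  "\<lbrakk>x \<in> carrier G; set ys \<subseteq> carrier G\<rbrakk> \<Longrightarrow> foldl (commutator G) x ys \<in> carrier G"
  by (induction ys rule: rev_induct) simp_all

text \<open>Each term of the series is generated, modulo the next one, by the left-normed commutators in a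
  generating set. In the induction step, the elements all of whose commutators lie in \<open>H\<close> form a subgroup
  to which the induction hypothesis applies.\<close>

lemma lower_central_subset_if_left_normed:
  assumes A: "A \<subseteq> carrier G" "generate G A = carrier G"
    and "subgroup H G" "lower_central G (Suc i) \<subseteq> H" "H \<subseteq> lower_central G i"
    and "\<And>x ys. \<lbrakk>x \<in> A; set ys \<subseteq> A; length ys = i\<rbrakk> \<Longrightarrow> foldl (commutator G) x ys \<in> H"
  shows "lower_central G i \<subseteq> H"
  using assms(3-)
proof (induction i arbitrary: H)
  case 0
  then have "A \<subseteq> H" by (metis empty_subsetI foldl_Nil list.set(1) list.size(3) subsetI)
  then have "generate G A \<subseteq> H" using 0(1) by (rule generate_subgroup_incl)
  then show ?case using A(2) by simp
next
  case (Suc i)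
  interpret H: normal H G using Suc.prems by (intro normal_between_lower_central)
  have cH: "commutator G v g \<in> H" if "v \<in> lower_central G (Suc i)" "g \<in> carrier G" for v g
    using commutator_lower_central[OF that] Suc.prems(2) by blast
  let ?K = "lower_central G i \<inter> centralizer_mod G H (carrier G)"
  have "lower_central G i \<subseteq> ?K"
  proof (rule Suc.IH)
    show "subgroup ?K G"
      by (intro subgroups_Inter_pair subgroup_lower_central H.subgroup_centralizer_mod) auto
    show "lower_central G (Suc i) \<subseteq> ?K"
      using lower_central_Suc_subset cH lower_central_closed by (auto simp: centralizer_mod_def)
    show "?K \<subseteq> lower_central G i" by blast
    fix x ys assume xys: "x \<in> A" "set ys \<subseteq> A" "length ys = i"
    define v where "v = foldl (commutator G) x ys"
    have v: "v \<in> lower_central G i" "v \<in> carrier G"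
      using left_normed_in_lower_central[of x ys] left_normed_closed[of x ys] xys A(1) by (auto simp: v_def)
    have vx: "commutator G v z \<in> H" if "z \<in> A" for z
      using Suc.prems(4)[of x "ys @ [z]"] xys that by (simp add: v_def)
    have "generate G A \<subseteq> centralizer_mod G H {v}"
    proof (rule generate_subgroup_incl)
      show "subgroup (centralizer_mod G H {v}) G" using v by (intro H.subgroup_centralizer_mod) auto
      show "A \<subseteq> centralizer_mod G H {v}"
        using vx A(1) H.commutator_mem_swap[OF v(2)] by (auto simp: centralizer_mod_def)
    qed
    then have "commutator G v g \<in> H" if "g \<in> carrier G" for g
      using that A(2) H.commutator_mem_swap[OF v(2)] by (auto simp: centralizer_mod_def)
    then show "foldl (commutator G) x ys \<in> ?K"
      using v unfolding v_def[symmetric] by (simp add: centralizer_mod_def)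
  qed
  then show ?case using Suc.prems(1) by (intro lower_central_Suc_minimal) (auto simp: centralizer_mod_def)
qed

end

text \<open>The Jacobi identity, iterated. Up to higher terms, \<open>[w, [u, z]]\<close> is a combination of \<open>[[w, u], z]\<close> and
  \<open>[[w, z], u]\<close>. The first is a commutator with the element \<open>z\<close> of \<open>J\<close>; in the second the left-normed
  commutator \<open>u\<close> is shorter while \<open>[w, z]\<close> lies one term deeper than \<open>w\<close>, so that the total depth
  \<open>length ys + s\<close> stays the same and induction applies.\<close>

lemma (in normal) commutator_left_normed_mem:
  assumes "lower_central G (Suc (Suc (length ys + s))) \<subseteq> H"
    and J: "J \<subseteq> carrier G" "\<And>v z. \<lbrakk>v \<in> lower_central G (length ys + s); z \<in> J\<rbrakk> \<Longrightarrow> commutator G v z \<in> H"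
    and "x \<in> J" "set ys \<subseteq> J" "w \<in> lower_central G s"
  shows "commutator G w (foldl (commutator G) x ys) \<in> H"
  using assms(1) J(2) assms(5,6)
proof (induction ys arbitrary: s w rule: rev_induct)
  case Nil then show ?case using \<open>x \<in> J\<close> by simp
next
  case (snoc z ys)
  let ?i = "length ys + Suc s"
  define u where "u = foldl (commutator G) x ys"
  have x: "x \<in> carrier G" and z: "z \<in> carrier G" "z \<in> J" using J(1) assms(4) snoc.prems by auto
  have u: "u \<in> lower_central G (length ys)" "u \<in> carrier G"
    using left_normed_in_lower_central[of x ys] left_normed_closed[of x ys] x snoc.prems(3) J(1) by (auto simp: u_def)
  have w: "w \<in> carrier G" using snoc.prems(4) by (rule lower_central_closed)
  have top: "h \<in> H" if "h \<in> lower_central G j" "Suc (Suc ?i) \<le> j" for h j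
    using that lower_central_antimono[OF that(2)] snoc.prems(1) by auto
  have cz: "commutator G v z \<in> H" if "v \<in> lower_central G ?i" for v
    using snoc.prems(2)[of v z] that z by simp
  have e: "commutator G w u \<in> lower_central G ?i"
    using commutator_lower_central_add[OF snoc.prems(4) u(1)] by (simp add: add.commute)
  have c: "commutator G w z \<in> lower_central G (Suc s)"
    using snoc.prems(4) z(1) by (rule commutator_lower_central)
  have uz: "commutator G u z \<in> lower_central G (Suc (length ys))"
    using u(1) z(1) by (rule commutator_lower_central)
  have IH: "commutator G v u \<in> H" if "v \<in> lower_central G (Suc s)" for v
    unfolding u_def
  proof (rule snoc.IH)
    show "lower_central G (Suc (Suc (length ys + Suc s))) \<subseteq> H" using snoc.prems(1) by simp
    show "commutator G v z \<in> H" if "v \<in> lower_central G (length ys + Suc s)" "z \<in> J" for v z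
      using snoc.prems(2)[of v z] that by simp
  qed (use snoc.prems that in auto)
  have "commutator G w (commutator G u z) \<in> H"
  proof (rule commutator_commutator_mem)
    show "commutator G (commutator G w u) (commutator G w z) \<in> H"
      using commutator_lower_central_add[OF e c] by (rule top) simp
    let ?C = "centralizer_mod G H {commutator G w u}"
    have C: "subgroup ?C G" using w u by (intro subgroup_centralizer_mod) auto
    have "commutator G (commutator G w u) (commutator G u z) \<in> H"
      using commutator_lower_central_add[OF e uz] by (rule top) simp
    then have "commutator G u z \<in> ?C" 
      using commutator_mem_swap[of "commutator G w u" "commutator G u z"] w u z by (auto simp: centralizer_mod_def)
    moreover have "z \<in> ?C"
      using cz[OF e] commutator_mem_swap[of "commutator G w u" z] w u z by (auto simp: centralizer_mod_def)
    ultimately have "commutator G u z \<otimes> z \<in> ?C" using C subgroup.m_closed by metis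
    then show "commutator G (commutator G w u) (u \<otimes> z \<otimes> inv u) \<in> H"
      using conj_eq_commutator_mult[OF u(2) z(1)] commutator_mem_swap[of "commutator G w u" "u \<otimes> z \<otimes> inv u"] w u z
      by (auto simp: centralizer_mod_def)
    show "commutator G (commutator G w z) u \<in> H" using c by (rule IH)
    \<comment> \<open>Conjugation by inv z turns the second entry into inv u, for which the induction hypothesis is available.\<close>
    let ?d = "inv z \<otimes> commutator G w z \<otimes> z"
    have d: "?d \<in> lower_central G (Suc s)"
      using c normal.inv_op_closed1[OF lower_central_normal z(1)] by blast
    have dc: "?d \<in> carrier G" using w z by simp
    have "u \<in> centralizer_mod G H {?d}"
      using IH[OF d] commutator_mem_swap[of ?d u] dc u by (auto simp: centralizer_mod_def)
    then have "inv u \<in> centralizer_mod G H {?d}"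
      using subgroup_centralizer_mod[of "{?d}"] dc subgroup.m_inv_closed by (metis empty_subsetI insert_subset)
    then have "commutator G ?d (inv u) \<in> H"
      using commutator_mem_swap[of ?d "inv u"] dc u by (auto simp: centralizer_mod_def)
    then have "z \<otimes> commutator G ?d (inv u) \<otimes> inv z \<in> H" using z inv_op_closed2 by blast
    moreover have "z \<otimes> commutator G ?d (inv u) \<otimes> inv z = commutator G (commutator G w z) (z \<otimes> inv u \<otimes> inv z)"
      using w z u by (simp add: commutator_def group_word_simps)
    ultimately show "commutator G (commutator G w z) (z \<otimes> inv u \<otimes> inv z) \<in> H" by simp
  qed (use w u z in auto)
  then show ?case by (simp add: u_def)
qed

lemma (in group_hom) hom_left_normed:
  "\<lbrakk>x \<in> carrier G; set ys \<subseteq> carrier G\<rbrakk> \<Longrightarrow> h (foldl (commutator G) x ys) = foldl (commutator H) (h x) (map h ys)"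
  by (induction ys rule: rev_induct) (simp_all add: hom_commutator G.left_normed_closed)

lemma (in group_hom) hom_lower_central:
  assumes "h ` carrier G = carrier H"
  shows "h ` lower_central G i = lower_central H i"
proof (induction i)
  case 0 show ?case using assms by simp
next
  case (Suc i)
  let ?A = "{commutator G x g |x g. x \<in> lower_central G i \<and> g \<in> carrier G}"
  let ?B = "{commutator H x g |x g. x \<in> lower_central H i \<and> g \<in> carrier H}"
  have "h ` ?A = ?B"
  proof safe
    fix x g assume "x \<in> lower_central G i" "g \<in> carrier G"
    then show "\<exists>x' g'. h (commutator G x g) = commutator H x' g' \<and> x' \<in> lower_central H i \<and> g' \<in> carrier H"
      using hom_commutator[of x g] G.lower_central_closed[of x i] hom_closed[of g] Suc.IH[symmetric]
      by (intro exI[of _ "h x"] exI[of _ "h g"]) auto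
  next
    fix x g assume "x \<in> lower_central H i" "g \<in> carrier H"
    then obtain x' g' where "x = h x'" "x' \<in> lower_central G i" "g = h g'" "g' \<in> carrier G"
      unfolding Suc.IH[symmetric] assms[symmetric] by auto
    then have "commutator H x g = h (commutator G x' g')" "commutator G x' g' \<in> ?A"
      using hom_commutator[of x' g'] G.lower_central_closed[of x' i] by auto
    then show "commutator H x g \<in> h ` ?A" by blast
  qed
  moreover have "?A \<subseteq> carrier G" using G.lower_central_closed by blast
  ultimately show ?case
    unfolding G.lower_central_Suc_eq H.lower_central_Suc_eq using generate_img[of ?A] by simp
qed

section \<open>Subgroups generated modulo the derived subgroup\<close>

context group
begin

lemma normal_if_contains_commutators:
  assumes "subgroup P G" "lower_central G (Suc 0) \<subseteq> P"
  shows "P \<lhd> G"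
  using normal_between_lower_central[OF assms] subgroup.subset[OF assms(1)] by simp

text \<open>The powers \<open>y\<^sup>j\<close> with \<open>j < m\<close> represent all cosets, since modulo \<open>P\<close> exponents only matter modulo \<open>m\<close>.\<close>

lemma card_generate_insert_le:
  assumes "P \<lhd> G" "finite P" and y: "y \<in> carrier G" and m: "0 < m" "y [^] (m::nat) \<in> P"
  shows "finite (generate G (insert y P))" "card (generate G (insert y P)) \<le> m * card P"
proof -
  interpret P: normal P G by (rule assms(1))
  interpret q: group_hom G "G Mod P" "(#>) P" by (rule P.group_hom_quotient)
  let ?U = "\<Union>j<m. P #> (y [^] j)"
  define V where "V = {e \<in> carrier G. P #> e \<in> generate (G Mod P) {P #> y}}"
  have V: "subgroup V G"
    unfolding V_def using y by (intro q.subgroup_of_preimage q.H.generate_is_subgroup) auto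
  have "insert y P \<subseteq> V"
  proof
    fix e assume e: "e \<in> insert y P"
    show "e \<in> V"
    proof (cases "e \<in> P")
      case True
      then have "P #> e = \<one>\<^bsub>G Mod P\<^esub>" by (simp add: P.rcos_const is_group)
      then show ?thesis using True P.mem_carrier generate.one[of "G Mod P"] by (auto simp: V_def simp del: one_FactGroup)
    qed (use e y in \<open>auto simp: V_def intro: generate.incl\<close>)
  qed
  then have "generate G (insert y P) \<subseteq> V" using V by (rule generate_subgroup_incl)
  also have "V \<subseteq> ?U"
  proof
    fix e assume "e \<in> V"
    then obtain k :: int where e: "e \<in> carrier G" and k: "P #> e = (P #> y) [^]\<^bsub>G Mod P\<^esub> k"
      using q.H.generate_pow[of "P #> y"] q.hom_closed[OF y] by (auto simp: V_def)
    have one: "(P #> y) [^]\<^bsub>G Mod P\<^esub> int m = \<one>\<^bsub>G Mod P\<^esub>"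
      using m(2) y P.FactGroup_pow[OF y, of m] by (simp add: int_pow_int P.rcos_const is_group)
    have "k = int m * (k div int m) + int (nat (k mod int m))" using m(1) by simp
    then have "P #> e = ((P #> y) [^]\<^bsub>G Mod P\<^esub> int m) [^]\<^bsub>G Mod P\<^esub> (k div int m)
        \<otimes>\<^bsub>G Mod P\<^esub> (P #> y) [^]\<^bsub>G Mod P\<^esub> int (nat (k mod int m))"
      unfolding k using q.H.int_pow_mult[OF q.hom_closed[OF y]] q.H.int_pow_pow[OF q.hom_closed[OF y]]
      by metis
    also have "\<dots> = (P #> y) [^]\<^bsub>G Mod P\<^esub> nat (k mod int m)"
      unfolding one using q.hom_closed[OF y] by (simp add: int_pow_int del: mult_FactGroup one_FactGroup)
    also have "\<dots> = P #> (y [^] nat (k mod int m))" using y by (rule P.FactGroup_pow)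
    finally have "e \<in> P #> (y [^] nat (k mod int m))"
      using e y P.coset_eq_iff by simp
    moreover have "nat (k mod int m) < m" using m(1) by (simp add: nat_less_iff)
    ultimately show "e \<in> ?U" by blast
  qed
  finally have sub: "generate G (insert y P) \<subseteq> ?U" .
  have "P #> g = (\<lambda>h. h \<otimes> g) ` P" for g by (auto simp: r_coset_def)
  then have fin: "finite (P #> g)" and le: "card (P #> g) \<le> card P" for g
    using assms(2) by (auto intro: card_image_le)
  then show "finite (generate G (insert y P))" using sub finite_subset by blast
  have "card (generate G (insert y P)) \<le> card ?U" using sub fin by (intro card_mono) auto
  also have "\<dots> \<le> (\<Sum>j<m. card (P #> (y [^] j)))" by (intro card_UN_le) auto
  also have "\<dots> \<le> (\<Sum>j<m. card P)" using le by (intro sum_mono) auto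
  finally show "card (generate G (insert y P)) \<le> m * card P" by simp
qed

lemma card_generate_union_le:
  assumes "subgroup P G" "finite P" "lower_central G (Suc 0) \<subseteq> P"
    and "finite Y" "Y \<subseteq> carrier G" "0 < m" "\<And>y. y \<in> Y \<Longrightarrow> y [^] (m::nat) \<in> P"
  shows "finite (generate G (Y \<union> P)) \<and> card (generate G (Y \<union> P)) \<le> m ^ card Y * card P"
  using assms(4,5,7)
proof (induction Y)
  case empty
  then show ?case using generate_subgroup_incl[OF order_refl assms(1)] generate.incl[of _ P G] assms(2)
    by (metis card_mono empty_subsetI finite_subset mult_1 power_0 card.empty sup_bot_left)
next
  case (insert y Y)
  let ?R = "generate G (Y \<union> P)"
  have YP: "Y \<union> P \<subseteq> carrier G" using insert.prems(1) subgroup.subset[OF assms(1)] by auto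
  have R: "subgroup ?R G" "P \<subseteq> ?R" 
    using generate_is_subgroup[OF YP] by (auto intro: generate.incl)
  have Rn: "?R \<lhd> G" using R assms(3) by (intro normal_if_contains_commutators) auto
  have IH: "finite ?R" "card ?R \<le> m ^ card Y * card P" using insert by auto
  have y: "y \<in> carrier G" "y [^] m \<in> ?R" using insert.prems R(2) by auto
  note le = card_generate_insert_le[OF Rn IH(1) y(1) assms(6) y(2)]
  have sub: "generate G (insert y Y \<union> P) \<subseteq> generate G (insert y ?R)"
    by (intro mono_generate) (auto intro: generate.incl)
  then have "card (generate G (insert y Y \<union> P)) \<le> card (generate G (insert y ?R))"
    using le(1) by (rule card_mono[rotated])
  also have "\<dots> \<le> m * (m ^ card Y * card P)" using le(2) IH(2) by (meson mult_le_mono2 order_trans)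
  finally show ?case using insert.hyps sub le(1) finite_subset by (auto simp: mult.assoc)
qed

text \<open>The order of an element of the quotient divides the order of the quotient.\<close>

lemma pow_index_mem:
  assumes "P \<lhd> G" "subgroup K G" "finite K" "P \<subseteq> K" "y \<in> K" "card K = m * card P"
  shows "y [^] (m::nat) \<in> P"
proof -
  interpret K: group "G\<lparr>carrier := K\<rparr>" using assms(2) by (rule subgroup_imp_group)
  have sP: "subgroup P (G\<lparr>carrier := K\<rparr>)"
    using assms normal_imp_subgroup subgroup_incl by blast
  have "P \<lhd> G\<lparr>carrier := K\<rparr>"
    using normal_restrict_supergroup[OF assms(2,1,4)] by simp
  then interpret P: normal P "G\<lparr>carrier := K\<rparr>" .
  interpret q: group_hom "G\<lparr>carrier := K\<rparr>" "G\<lparr>carrier := K\<rparr> Mod P" "(#>\<^bsub>G\<lparr>carrier := K\<rparr>\<^esub>) P"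
    by (rule P.group_hom_quotient)
  have "card P > 0" using assms(3,4) P.one_closed by (metis card_gt_0_iff empty_iff finite_subset)
  moreover have "card (rcosets\<^bsub>G\<lparr>carrier := K\<rparr>\<^esub> P) * card P = card K"
    using K.lagrange[OF sP] by (simp add: order_def)
  ultimately have "order (G\<lparr>carrier := K\<rparr> Mod P) = m"
    using assms(6) by (simp add: order_def FactGroup_def)
  then have "(P #>\<^bsub>G\<lparr>carrier := K\<rparr>\<^esub> y) [^]\<^bsub>G\<lparr>carrier := K\<rparr> Mod P\<^esub> m = \<one>\<^bsub>G\<lparr>carrier := K\<rparr> Mod P\<^esub>"
    using q.H.pow_order_eq_1[of "P #>\<^bsub>G\<lparr>carrier := K\<rparr>\<^esub> y"] q.hom_closed[of y] assms(5) by simp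
  then have "P #>\<^bsub>G\<lparr>carrier := K\<rparr>\<^esub> (y [^]\<^bsub>G\<lparr>carrier := K\<rparr>\<^esub> m) = P"
    using P.FactGroup_pow[of y m] assms(5) by simp
  then have "y [^]\<^bsub>G\<lparr>carrier := K\<rparr>\<^esub> m \<in> P"
    using P.coset_eq_self_iff[of "y [^]\<^bsub>G\<lparr>carrier := K\<rparr>\<^esub> m"] K.nat_pow_closed[of y m] assms(5) by simp
  then show ?thesis using nat_pow_consistent[of y m] by simp
qed

lemma index_of_subgroup:
  assumes "subgroup K G" "subgroup P G" "P \<subseteq> K" "finite K"
  obtains m where "card K = m * card P" "0 < m"
proof -
  interpret K: group "G\<lparr>carrier := K\<rparr>" using assms(1) by (rule subgroup_imp_group)
  have "subgroup P (G\<lparr>carrier := K\<rparr>)" using assms subgroup_incl by blast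
  then have "card (rcosets\<^bsub>G\<lparr>carrier := K\<rparr>\<^esub> P) * card P = card K"
    using K.lagrange by (simp add: order_def)
  moreover have "card K > 0" using assms(1,4) subgroup.one_closed by (metis card_gt_0_iff empty_iff)
  ultimately show ?thesis using that by (metis mult_is_0 neq0_conv)
qed

end

section \<open>Central extensions of a finite group\<close>

text \<open>The kernel, and with it \<open>E\<close>, may be infinite, as it is for the extension defined by the bar complex.\<close>

locale central_extension = E: group E + Q: group Q
  for E (structure) and Q +
  fixes \<pi>
  assumes hom: "\<pi> \<in> hom E Q"
    and surj: "\<pi> ` carrier E = carrier Q"
    and central: "\<lbrakk>c \<in> carrier E; \<pi> c = \<one>\<^bsub>Q\<^esub>; g \<in> carrier E\<rbrakk> \<Longrightarrow> c \<otimes> g = g \<otimes> c"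
    and finite_Q: "finite (carrier Q)"
begin

sublocale \<pi>: group_hom E Q \<pi> by (unfold_locales) (rule hom)

lemma commutator_kernel_left:
  "\<lbrakk>c \<in> carrier E; \<pi> c = \<one>\<^bsub>Q\<^esub>; g \<in> carrier E\<rbrakk> \<Longrightarrow> commutator E c g = \<one>"
  using central E.commutator_eq_one_iff by simp

lemma image_lower_central: "\<pi> ` lower_central E i = lower_central Q i"
  using surj by (rule \<pi>.hom_lower_central)

lemma image_subgroup: "subgroup K E \<Longrightarrow> subgroup (\<pi> ` K) Q"
  by (rule \<pi>.subgroup_img_is_subgroup)

lemma finite_subgroup: "subgroup K Q \<Longrightarrow> finite K"
  using finite_Q subgroup.subset finite_subset by metis

lemma eq_kernel_mult:
  assumes "e \<in> carrier E" "g \<in> carrier E" "\<pi> e = \<pi> g"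
  obtains c where "c \<in> carrier E" "\<pi> c = \<one>\<^bsub>Q\<^esub>" "e = c \<otimes> g"
  using that[of "e \<otimes> inv g"] assms by (simp add: E.m_assoc)

text \<open>Passing to images under \<open>\<pi>\<close> does not change the index as long as both groups have the same
  intersection with the kernel.\<close>

lemma coset_covered_if_image:
  assumes K: "subgroup K E" and L: "subgroup L E" "L \<subseteq> K"
    and ker: "\<And>c. c \<in> K \<Longrightarrow> \<pi> c = \<one>\<^bsub>Q\<^esub> \<Longrightarrow> c \<in> L"
    and card: "card (\<pi> ` K) \<le> N * card (\<pi> ` L)"
  shows "coset_covered E K L N"
proof -
  let ?A = "\<pi> ` K" and ?B = "\<pi> ` L"
  let ?f = "\<lambda>k. ?B #>\<^bsub>Q\<^esub> \<pi> k"
  have KE: "k \<in> carrier E" if "k \<in> K" for k using subgroup.mem_carrier[OF K that] .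
  have A: "subgroup ?A Q" and B: "subgroup ?B Q" using K L by (auto intro: image_subgroup)
  interpret A: group "Q\<lparr>carrier := ?A\<rparr>" using A by (rule Q.subgroup_imp_group)
  have "subgroup ?B (Q\<lparr>carrier := ?A\<rparr>)" using A B L(2) by (intro Q.subgroup_incl) auto
  then have "card (rcosets\<^bsub>Q\<lparr>carrier := ?A\<rparr>\<^esub> ?B) * card ?B = card ?A"
    using A.lagrange by (simp add: order_def)
  moreover have "rcosets\<^bsub>Q\<lparr>carrier := ?A\<rparr>\<^esub> ?B = ?f ` K" by (auto simp: RCOSETS_def)
  ultimately have "card (?f ` K) * card ?B \<le> N * card ?B" using card by simp
  moreover have "card ?B > 0"
    using finite_subgroup[OF B] subgroup.one_closed[OF B] by (metis card_gt_0_iff empty_iff)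
  ultimately have le: "card (?f ` K) \<le> N" by simp
  obtain T where T: "T \<subseteq> K" "inj_on ?f T" "?f ` K = ?f ` T"
    using subset_image_inj[of "?f ` K" ?f K] by auto
  have "finite (?f ` K)" using finite_subgroup[OF A] by (metis finite_imageI image_image)
  then have "finite T" using T finite_image_iff by metis
  moreover have "card T \<le> N" using le T card_image by metis
  moreover have "K \<subseteq> L <#> T"
  proof
    fix k assume k: "k \<in> K"
    then have "?f k \<in> ?f ` T" unfolding T(3)[symmetric] by (rule imageI)
    then obtain t where t: "t \<in> T" "?f k = ?f t" by (rule imageE)
    have tK: "t \<in> K" using t T by blast
    have "\<pi> k \<in> ?B #>\<^bsub>Q\<^esub> \<pi> t" using t(2) Q.rcos_self[OF _ B] KE[OF k] by auto
    then obtain l where l: "l \<in> L" "\<pi> k = \<pi> l \<otimes>\<^bsub>Q\<^esub> \<pi> t" by (auto simp: r_coset_def)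
    have lK: "l \<in> K" using l L by blast
    have "\<pi> k = \<pi> (l \<otimes> t)" using l(2) KE[OF lK] KE[OF tK] by simp
    then obtain c where c: "c \<in> carrier E" "\<pi> c = \<one>\<^bsub>Q\<^esub>" "k = c \<otimes> (l \<otimes> t)"
      using eq_kernel_mult KE k lK tK E.m_closed by metis
    have "c = k \<otimes> inv (l \<otimes> t)"
      using c KE[OF k] KE[OF lK] KE[OF tK] E.inv_solve_right by simp
    then have "c \<in> K" using k lK tK K by (simp add: subgroup.m_closed subgroup.m_inv_closed)
    then have "c \<in> L" using ker c by simp
    then have "c \<otimes> l \<in> L" using l L(1) by (simp add: subgroup.m_closed)
    moreover have "k = (c \<otimes> l) \<otimes> t" using c KE[OF lK] KE[OF tK] by (simp add: E.m_assoc)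
    ultimately show "k \<in> L <#> T" using t(1) by (auto simp: set_mult_def)
  qed
  ultimately show ?thesis using T(1) unfolding coset_covered_def by blast
qed

section \<open>Layers of the lower central series of an extension\<close>

text \<open>These subgroups interpolate between two consecutive terms of the lower central series of \<open>E\<close>: the
  deeper one for empty \<open>J\<close>, the other one when the image of \<open>J\<close> generates \<open>Q\<close>. Adding one element
  to \<open>J\<close> at a time splits the layer into images of homomorphisms \<open>u \<mapsto> [u, x]\<close>.\<close>

definition layer_subgroup :: "nat \<Rightarrow> 'a set \<Rightarrow> 'a set"
  where "layer_subgroup i J = generate E (lower_central E (Suc (Suc i)) \<union>
    {commutator E u x |u x. u \<in> lower_central E i \<and> x \<in> J})"

context
  fixes i :: nat and J :: "'a set"
  assumes J: "J \<subseteq> carrier E"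
begin

lemma layer_generators_closed:
  "lower_central E (Suc (Suc i)) \<union> {commutator E u x |u x. u \<in> lower_central E i \<and> x \<in> J} \<subseteq> carrier E"
  using J E.lower_central_closed by blast

lemma subgroup_layer: "subgroup (layer_subgroup i J) E"
  unfolding layer_subgroup_def using layer_generators_closed by (rule E.generate_is_subgroup)

lemma lower_central_subset_layer: "lower_central E (Suc (Suc i)) \<subseteq> layer_subgroup i J"
  unfolding layer_subgroup_def by (auto intro: generate.incl)

lemma commutator_mem_layer:
  "u \<in> lower_central E i \<Longrightarrow> x \<in> J \<Longrightarrow> commutator E u x \<in> layer_subgroup i J"
  unfolding layer_subgroup_def by (rule generate.incl) blast

lemma layer_subset_lower_central: "layer_subgroup i J \<subseteq> lower_central E (Suc i)"
  unfolding layer_subgroup_def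
  using J E.lower_central_Suc_subset[of "Suc i"] E.commutator_lower_central[of _ i]
  by (intro E.generate_subgroup_incl E.subgroup_lower_central) auto

lemma normal_layer: "layer_subgroup i J \<lhd> E"
  using subgroup_layer lower_central_subset_layer layer_subset_lower_central
  by (rule E.normal_between_lower_central)

lemma central_commutators_layer:
  assumes "x \<in> carrier E"
  shows "central_commutators (layer_subgroup i J) E (lower_central E i) x"
proof -
  interpret normal "layer_subgroup i J" E by (rule normal_layer)
  show ?thesis
  proof (intro central_commutators.intro central_commutators_axioms.intro)
    fix k g assume "k \<in> lower_central E i" "g \<in> carrier E"
    then show "commutator E (commutator E k x) g \<in> layer_subgroup i J"
      using E.commutator_lower_central[OF E.commutator_lower_central] lower_central_subset_layer assms by blast
  qed (rule normal_layer E.subgroup_lower_central assms)+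
qed

lemma layer_insert:
  assumes x: "x \<in> carrier E"
  shows "layer_subgroup i (insert x J) = commutator_span E (layer_subgroup i J) (lower_central E i) x"
proof -
  interpret C: central_commutators "layer_subgroup i J" E "lower_central E i" x
    using x by (rule central_commutators_layer)
  show ?thesis
  proof
    show "layer_subgroup i (insert x J) \<subseteq> commutator_span E (layer_subgroup i J) (lower_central E i) x"
      unfolding layer_subgroup_def[of _ "insert x J"]
      using C.subset_commutator_span C.commutator_in_span lower_central_subset_layer commutator_mem_layer
      by (intro E.generate_subgroup_incl C.subgroup_commutator_span) blast
  next
    have mono: "layer_subgroup i J \<subseteq> layer_subgroup i (insert x J)"
      unfolding layer_subgroup_def by (intro E.mono_generate) blast
    have sub: "subgroup (layer_subgroup i (insert x J)) E"
      unfolding layer_subgroup_def using J x E.lower_central_closed by (intro E.generate_is_subgroup) blast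
    have "commutator E k x \<in> layer_subgroup i (insert x J)" if "k \<in> lower_central E i" for k
      unfolding layer_subgroup_def using that by (intro generate.incl) blast
    then show "commutator_span E (layer_subgroup i J) (lower_central E i) x \<subseteq> layer_subgroup i (insert x J)"
      using mono subgroup.m_closed[OF sub] unfolding commutator_span_def set_mult_def by blast
  qed
qed

end

lemma layer_mono: "J \<subseteq> J' \<Longrightarrow> layer_subgroup i J \<subseteq> layer_subgroup i J'"
  unfolding layer_subgroup_def by (intro E.mono_generate) blast

lemma layer_empty: "layer_subgroup i {} = lower_central E (Suc (Suc i))"
  unfolding layer_subgroup_def
  using E.generate_subgroup_incl[OF order_refl E.subgroup_lower_central[of "Suc (Suc i)"]]
  by (auto intro: generate.incl)

text \<open>The hypothesis on \<open>z\<close> says that modulo the starting subgroup the kernel of \<open>u \<mapsto> [u, z]\<close> has index at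
  most \<open>M\<close>. This persists while \<open>J\<close> grows, so that each element of \<open>Z\<close> costs a factor of at most \<open>M\<close>.\<close>

lemma layer_extend_covered:
  assumes "finite Z" "Z \<subseteq> carrier E" "J \<subseteq> carrier E"
    and M: "\<And>z. z \<in> Z \<Longrightarrow> card (lower_central Q i)
      \<le> M * card (\<pi> ` {k \<in> lower_central E i. commutator E k z \<in> layer_subgroup i J})"
  shows "coset_covered E (layer_subgroup i (J \<union> Z)) (layer_subgroup i J) (M ^ card Z)"
  using assms(1,2) M
proof (induction Z)
  case empty
  then show ?case using E.coset_covered_refl subgroup_layer[OF assms(3)] by simp
next
  case (insert z Z)
  have JZ: "J \<union> Z \<subseteq> carrier E" and z: "z \<in> carrier E" using insert assms(3) by auto
  interpret C: central_commutators "layer_subgroup i (J \<union> Z)" E "lower_central E i" z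
    using JZ z by (rule central_commutators_layer)
  let ?L = "{k \<in> lower_central E i. commutator E k z \<in> layer_subgroup i (J \<union> Z)}"
  let ?M = "{k \<in> lower_central E i. commutator E k z \<in> layer_subgroup i J}"
  have "coset_covered E (lower_central E i) ?L M"
  proof (rule coset_covered_if_image[OF E.subgroup_lower_central C.subgroup_kernel_commutator])
    have "?M \<subseteq> ?L" using layer_mono[of J "J \<union> Z"] by auto
    moreover have "finite (\<pi> ` ?L)"
      using finite_subgroup[OF image_subgroup[OF C.subgroup_kernel_commutator]] .
    ultimately have "card (\<pi> ` ?M) \<le> card (\<pi> ` ?L)" by (intro card_mono image_mono)
    moreover have "card (lower_central Q i) \<le> M * card (\<pi> ` ?M)" using insert.prems(2) by simp
    ultimately show "card (\<pi> ` lower_central E i) \<le> M * card (\<pi> ` ?L)"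
      unfolding image_lower_central by (meson mult_le_mono2 order_trans)
  next
    fix c assume c: "c \<in> lower_central E i" "\<pi> c = \<one>\<^bsub>Q\<^esub>"
    then show "c \<in> ?L"
      using commutator_kernel_left[of c z] E.lower_central_closed z subgroup.one_closed[OF subgroup_layer[OF JZ]] by auto
  qed auto
  then have step: "coset_covered E (layer_subgroup i (insert z (J \<union> Z))) (layer_subgroup i (J \<union> Z)) M"
    unfolding layer_insert[OF JZ z] by (rule C.commutator_span_covered)
  have "coset_covered E (layer_subgroup i (insert z (J \<union> Z))) (layer_subgroup i J) (M * M ^ card Z)"
  proof (rule E.coset_covered_trans[OF _ _ _ step])
    show "subgroup (layer_subgroup i (insert z (J \<union> Z))) E" using JZ z by (intro subgroup_layer) auto
    show "layer_subgroup i (J \<union> Z) \<subseteq> layer_subgroup i (insert z (J \<union> Z))" by (intro layer_mono) auto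
    show "layer_subgroup i J \<subseteq> carrier E" using subgroup.subset[OF subgroup_layer[OF assms(3)]] .
    show "coset_covered E (layer_subgroup i (J \<union> Z)) (layer_subgroup i J) (M ^ card Z)"
      using insert by simp
  qed
  then show ?case using insert.hyps by simp
qed

end

context central_extension
begin

text \<open>Elements with the same image differ by an element of the kernel.\<close>

lemma subset_if_contains_generators:
  assumes C: "subgroup C E" and A: "A \<subseteq> C"
    and ker: "\<And>c. c \<in> carrier E \<Longrightarrow> \<pi> c = \<one>\<^bsub>Q\<^esub> \<Longrightarrow> c \<in> C"
    and e: "e \<in> carrier E" "\<pi> e \<in> generate Q (\<pi> ` A)"
  shows "e \<in> C"
proof -
  have AE: "A \<subseteq> carrier E" using A subgroup.subset[OF C] by blast
  have "\<pi> e \<in> \<pi> ` generate E A" using e(2) \<pi>.generate_img[OF AE] by simp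
  then obtain g where g: "g \<in> generate E A" "\<pi> e = \<pi> g" by (rule imageE)
  have gE: "g \<in> carrier E" using E.generate_in_carrier[OF AE g(1)] .
  have gC: "g \<in> C" using g(1) E.generate_subgroup_incl[OF A C] by blast
  obtain c where c: "c \<in> carrier E" "\<pi> c = \<one>\<^bsub>Q\<^esub>" "e = c \<otimes> g"
    using eq_kernel_mult[OF e(1) gE g(2)] by blast
  show ?thesis unfolding c(3) using subgroup.m_closed[OF C ker[OF c(1,2)] gC] .
qed

text \<open>The elements whose commutators with the term \<open>i\<close> lie in the layer subgroup form a subgroup. It contains
  the kernel, by centrality, and lifts of generators, hence everything.\<close>

lemma layer_full:
  assumes A: "A \<subseteq> carrier E" "generate Q (\<pi> ` A) = carrier Q"
  shows "layer_subgroup i A = lower_central E (Suc i)"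
proof (rule antisym[OF layer_subset_lower_central[OF A(1)]])
  interpret L: normal "layer_subgroup i A" E using A(1) by (rule normal_layer)
  let ?C = "centralizer_mod E (layer_subgroup i A) (lower_central E i)"
  have sub: "lower_central E i \<subseteq> carrier E" using E.lower_central_closed by blast
  have "g \<in> ?C" if g: "g \<in> carrier E" for g
  proof (rule subset_if_contains_generators[OF _ _ _ g])
    show "subgroup ?C E" using sub by (rule L.subgroup_centralizer_mod)
    show "A \<subseteq> ?C"
    proof
      fix x assume x: "x \<in> A"
      then have "commutator E x u \<in> layer_subgroup i A" if "u \<in> lower_central E i" for u
        using commutator_mem_layer[OF A(1) that x] L.commutator_mem_swap[of x u] A(1) sub that by blast
      then show "x \<in> ?C" using x A(1) by (auto simp: centralizer_mod_def)
    qed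
    show "\<pi> g \<in> generate Q (\<pi> ` A)" using g A(2) by simp
    show "c \<in> ?C" if "c \<in> carrier E" "\<pi> c = \<one>\<^bsub>Q\<^esub>" for c
      using that sub commutator_kernel_left L.one_closed by (auto simp: centralizer_mod_def)
  qed
  then have "commutator E g u \<in> layer_subgroup i A" if "u \<in> lower_central E i" "g \<in> carrier E" for u g
    using that by (auto simp: centralizer_mod_def)
  then have "commutator E u g \<in> layer_subgroup i A" if "u \<in> lower_central E i" "g \<in> carrier E" for u g
    using that L.commutator_mem_swap[of u g] sub by blast
  then show "lower_central E (Suc i) \<subseteq> layer_subgroup i A"
    by (intro E.lower_central_Suc_minimal L.subgroup_axioms)
qed

section \<open>The top layer\<close>

definition span_mod_derived :: "'a set \<Rightarrow> 'c set"
  where "span_mod_derived Y = generate Q (\<pi> ` Y \<union> lower_central Q (Suc 0))"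

lemma span_mod_derived_gens_closed:
  "Y \<subseteq> carrier E \<Longrightarrow> \<pi> ` Y \<union> lower_central Q (Suc 0) \<subseteq> carrier Q"
  using Q.lower_central_closed[of _ "Suc 0"] by auto

lemma subgroup_span: "Y \<subseteq> carrier E \<Longrightarrow> subgroup (span_mod_derived Y) Q"
  unfolding span_mod_derived_def by (intro Q.generate_is_subgroup span_mod_derived_gens_closed)

lemma derived_subset_span: "lower_central Q (Suc 0) \<subseteq> span_mod_derived Y"
  unfolding span_mod_derived_def by (auto intro: generate.incl)

lemma image_mem_span: "y \<in> Y \<Longrightarrow> \<pi> y \<in> span_mod_derived Y"
  unfolding span_mod_derived_def by (auto intro: generate.incl)

lemma normal_span: "Y \<subseteq> carrier E \<Longrightarrow> span_mod_derived Y \<lhd> Q"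
  using subgroup_span derived_subset_span by (rule Q.normal_if_contains_commutators)

lemma span_mono: "Y \<subseteq> Z \<Longrightarrow> span_mod_derived Y \<subseteq> span_mod_derived Z"
  unfolding span_mod_derived_def by (intro Q.mono_generate) blast

lemma span_empty: "span_mod_derived {} = lower_central Q (Suc 0)"
  unfolding span_mod_derived_def
  using Q.generate_subgroup_incl[OF order_refl Q.subgroup_lower_central[of "Suc 0"]]
  by (auto intro: generate.incl)

lemma finite_span: "Y \<subseteq> carrier E \<Longrightarrow> finite (span_mod_derived Y)"
  using finite_subgroup subgroup_span by blast

lemma card_span_pos: "Y \<subseteq> carrier E \<Longrightarrow> card (span_mod_derived Y) > 0"
  using finite_span subgroup.one_closed[OF subgroup_span] by (metis card_gt_0_iff empty_iff)

lemma card_span_insert_le: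
  assumes "Y \<subseteq> carrier E" "y \<in> carrier E" "0 < m" "\<pi> y [^]\<^bsub>Q\<^esub> (m::nat) \<in> span_mod_derived Y"
  shows "card (span_mod_derived (insert y Y)) \<le> m * card (span_mod_derived Y)"
proof -
  note le = Q.card_generate_insert_le[OF normal_span[OF assms(1)] finite_span[OF assms(1)] _ assms(3,4)]
  have "span_mod_derived (insert y Y) \<subseteq> generate Q (insert (\<pi> y) (span_mod_derived Y))"
    unfolding span_mod_derived_def[of "insert y Y"]
    using derived_subset_span image_mem_span by (intro Q.mono_generate) auto
  then show ?thesis using le assms(2) card_mono order_trans by (metis \<pi>.hom_closed)
qed

text \<open>Adding \<open>z\<close> to a smaller span multiplies its order by at least the index that \<open>z\<close> contributes on top
  of all other elements of \<open>Y\<close>, and that index is at least \<open>m\<close>.\<close>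

lemma power_le_card_span:
  assumes "finite Z" "Z \<subseteq> Y" "Y \<subseteq> carrier E"
    and o: "\<And>y. y \<in> Y \<Longrightarrow> m * card (span_mod_derived (Y - {y})) \<le> card (span_mod_derived Y)"
  shows "m ^ card Z * card (lower_central Q (Suc 0)) \<le> card (span_mod_derived Z)"
  using assms(1,2)
proof (induction Z)
  case empty show ?case by (simp add: span_empty)
next
  case (insert z Z)
  have zY: "z \<in> Y" "Z \<subseteq> Y - {z}" "Z \<subseteq> carrier E" "insert z Z \<subseteq> carrier E" "Y - {z} \<subseteq> carrier E" "z \<in> carrier E"
    using insert assms(3) by auto
  obtain j where j: "card (span_mod_derived (insert z Z)) = j * card (span_mod_derived Z)" "0 < j"
    by (rule Q.index_of_subgroup[OF subgroup_span[OF zY(4)] subgroup_span[OF zY(3)] span_mono[OF subset_insertI] finite_span[OF zY(4)]])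
  have "\<pi> z [^]\<^bsub>Q\<^esub> j \<in> span_mod_derived Z"
    using j(1) by (rule Q.pow_index_mem[OF normal_span[OF zY(3)] subgroup_span[OF zY(4)] finite_span[OF zY(4)] span_mono[OF subset_insertI] image_mem_span[OF insertI1]])
  then have "\<pi> z [^]\<^bsub>Q\<^esub> j \<in> span_mod_derived (Y - {z})" using span_mono[OF zY(2)] by blast
  then have "card (span_mod_derived Y) \<le> j * card (span_mod_derived (Y - {z}))"
    using card_span_insert_le[OF zY(5,6) j(2)] zY(1) by (simp add: insert_absorb)
  \<comment> \<open>The index j of the smaller span is therefore at least that of z over Y - {z}.\<close>
  then have "m * card (span_mod_derived (Y - {z})) \<le> j * card (span_mod_derived (Y - {z}))"
    using o[OF zY(1)] by (rule order_trans[rotated])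
  then have "m \<le> j" using card_span_pos[OF zY(5)] by simp
  moreover have "m ^ card Z * card (lower_central Q (Suc 0)) \<le> card (span_mod_derived Z)"
    using insert by simp
  ultimately have "m * (m ^ card Z * card (lower_central Q (Suc 0))) \<le> j * card (span_mod_derived Z)"
    by (rule mult_le_mono)
  then show ?case using insert.hyps j(1) by (simp add: mult.assoc)
qed

definition mutual_commutators :: "'a set \<Rightarrow> 'a set"
  where "mutual_commutators Y = generate E (lower_central E (Suc (Suc 0)) \<union>
    {commutator E a b |a b. a \<in> Y \<and> b \<in> Y})"

definition span_preimage :: "'a set \<Rightarrow> 'a set"
  where "span_preimage Y = {e \<in> carrier E. \<pi> e \<in> span_mod_derived Y}"

lemma subgroup_span_preimage: "Y \<subseteq> carrier E \<Longrightarrow> subgroup (span_preimage Y) E"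
  unfolding span_preimage_def by (intro \<pi>.subgroup_of_preimage subgroup_span)

lemma image_span_preimage: "Y \<subseteq> carrier E \<Longrightarrow> \<pi> ` span_preimage Y = span_mod_derived Y"
  using subgroup.subset[OF subgroup_span[of Y]] surj by (fastforce simp: span_preimage_def)

lemma span_preimage_subset:
  assumes C: "subgroup C E" "Y \<subseteq> C" "lower_central E (Suc 0) \<subseteq> C"
    and ker: "\<And>c. c \<in> carrier E \<Longrightarrow> \<pi> c = \<one>\<^bsub>Q\<^esub> \<Longrightarrow> c \<in> C"
  shows "span_preimage Y \<subseteq> C"
proof
  fix e assume "e \<in> span_preimage Y"
  moreover have "\<pi> ` (Y \<union> lower_central E (Suc 0)) = \<pi> ` Y \<union> lower_central Q (Suc 0)"
    by (simp only: image_Un image_lower_central)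
  ultimately have "e \<in> carrier E" "\<pi> e \<in> generate Q (\<pi> ` (Y \<union> lower_central E (Suc 0)))"
    by (auto simp only: span_preimage_def span_mod_derived_def mem_Collect_eq)
  moreover have "Y \<union> lower_central E (Suc 0) \<subseteq> C" using C by blast
  ultimately show "e \<in> C" using subset_if_contains_generators[OF C(1)] ker by blast
qed

context
  fixes Y :: "'a set"
  assumes Y: "Y \<subseteq> carrier E"
begin

lemma mutual_gens_closed:
  "lower_central E (Suc (Suc 0)) \<union> {commutator E a b |a b. a \<in> Y \<and> b \<in> Y} \<subseteq> carrier E"
  using Y E.lower_central_closed by blast

lemma subgroup_mutual: "subgroup (mutual_commutators Y) E"
  unfolding mutual_commutators_def using mutual_gens_closed by (rule E.generate_is_subgroup)

lemma lower_central_subset_mutual: "lower_central E (Suc (Suc 0)) \<subseteq> mutual_commutators Y"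
  unfolding mutual_commutators_def by (auto intro: generate.incl)

lemma commutator_mem_lower_central_1:
  "a \<in> carrier E \<Longrightarrow> b \<in> carrier E \<Longrightarrow> commutator E a b \<in> lower_central E (Suc 0)"
  using E.commutator_lower_central[of a 0 b] by simp

lemma mutual_subset_lower_central: "mutual_commutators Y \<subseteq> lower_central E (Suc 0)"
  unfolding mutual_commutators_def
proof (intro E.generate_subgroup_incl E.subgroup_lower_central Un_least)
  show "lower_central E (Suc (Suc 0)) \<subseteq> lower_central E (Suc 0)" by (rule E.lower_central_Suc_subset)
  show "{commutator E a b |a b. a \<in> Y \<and> b \<in> Y} \<subseteq> lower_central E (Suc 0)"
    using Y commutator_mem_lower_central_1 by blast
qed

lemma normal_mutual: "mutual_commutators Y \<lhd> E"
  using subgroup_mutual lower_central_subset_mutual mutual_subset_lower_central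
  by (rule E.normal_between_lower_central)

lemma commutator_commutator_mem_mutual:
  "\<lbrakk>a \<in> carrier E; b \<in> carrier E; g \<in> carrier E\<rbrakk> \<Longrightarrow> commutator E (commutator E a b) g \<in> mutual_commutators Y"
  using E.commutator_lower_central[OF commutator_mem_lower_central_1] lower_central_subset_mutual by blast

lemma central_commutators_mutual:
  assumes "x \<in> carrier E" "subgroup K E"
  shows "central_commutators (mutual_commutators Y) E K x"
proof (intro central_commutators.intro central_commutators_axioms.intro normal_mutual assms)
  fix k g assume "k \<in> K" "g \<in> carrier E"
  then show "commutator E (commutator E k x) g \<in> mutual_commutators Y"
    using assms subgroup.mem_carrier[OF assms(2)] by (intro commutator_commutator_mem_mutual) auto
qed

lemma span_preimage_centralizes:
  assumes "B \<subseteq> carrier E" "\<And>y b. \<lbrakk>y \<in> Y; b \<in> B\<rbrakk> \<Longrightarrow> commutator E y b \<in> mutual_commutators Y"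
  shows "span_preimage Y \<subseteq> centralizer_mod E (mutual_commutators Y) B"
proof -
  interpret M: normal "mutual_commutators Y" E by (rule normal_mutual)
  show ?thesis
  proof (rule span_preimage_subset)
    show "subgroup (centralizer_mod E (mutual_commutators Y) B) E"
      using assms(1) by (rule M.subgroup_centralizer_mod)
    show "Y \<subseteq> centralizer_mod E (mutual_commutators Y) B"
      using assms Y by (auto simp: centralizer_mod_def)
    show "lower_central E (Suc 0) \<subseteq> centralizer_mod E (mutual_commutators Y) B"
      using assms(1) E.commutator_lower_central[of _ "Suc 0"] lower_central_subset_mutual E.lower_central_closed[of _ "Suc 0"]
      by (auto simp: centralizer_mod_def)
    show "c \<in> centralizer_mod E (mutual_commutators Y) B" if "c \<in> carrier E" "\<pi> c = \<one>\<^bsub>Q\<^esub>" for c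
      using that assms(1) commutator_kernel_left M.one_closed by (auto simp: centralizer_mod_def)
  qed
qed

text \<open>Modulo \<open>mutual_commutators Y\<close> the elements of \<open>Y\<close> commute with each other. Passing from \<open>Y\<close> to its
  span in the first argument and then in the second one shows that the whole preimage is commutative.\<close>

lemma commutator_span_preimage_mem:
  assumes "a \<in> span_preimage Y" "b \<in> span_preimage Y"
  shows "commutator E a b \<in> mutual_commutators Y"
proof -
  interpret M: normal "mutual_commutators Y" E by (rule normal_mutual)
  have sub: "span_preimage Y \<subseteq> carrier E" by (auto simp: span_preimage_def)
  have "commutator E y b \<in> mutual_commutators Y" if "y \<in> Y" "b \<in> Y" for y b
    unfolding mutual_commutators_def using that by (intro generate.incl) blast
  then have 1: "span_preimage Y \<subseteq> centralizer_mod E (mutual_commutators Y) Y"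
    using Y by (intro span_preimage_centralizes)
  then have "commutator E y b \<in> mutual_commutators Y" if "y \<in> Y" "b \<in> span_preimage Y" for y b
    using that sub Y M.commutator_mem_swap[of y b] by (auto simp: centralizer_mod_def)
  then have "span_preimage Y \<subseteq> centralizer_mod E (mutual_commutators Y) (span_preimage Y)"
    using sub by (intro span_preimage_centralizes)
  then show ?thesis using assms by (auto simp: centralizer_mod_def)
qed

text \<open>Because \<open>x\<^sup>m\<close> is in the span of \<open>Y\<close>, bilinearity gives \<open>[y\<^sup>m, x] = [y, x\<^sup>m] = 1\<close> modulo the
  mutual commutators. So the kernel of \<open>k \<mapsto> [k, x]\<close> contains \<open>m\<close>-th powers of the generators of the
  span, and has index at most \<open>m\<close> to the number of generators.\<close>

lemma kernel_commutator_covered: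
  assumes fin: "finite Y" and x: "x \<in> carrier E" and m: "0 < m" "x [^] (m::nat) \<in> span_preimage Y"
  shows "coset_covered E (span_preimage Y) {k \<in> span_preimage Y. commutator E k x \<in> mutual_commutators Y} (m ^ card Y)"
proof -
  let ?W = "mutual_commutators Y"
  let ?L = "{k \<in> span_preimage Y. commutator E k x \<in> ?W}"
  interpret C: central_commutators ?W E "span_preimage Y" x
    using x subgroup_span_preimage[OF Y] by (rule central_commutators_mutual)
  have L: "subgroup ?L E" by (rule C.subgroup_kernel_commutator)
  have sub: "span_preimage Y \<subseteq> carrier E" by (auto simp: span_preimage_def)
  have ker_span: "c \<in> span_preimage Y" if "c \<in> carrier E" "\<pi> c = \<one>\<^bsub>Q\<^esub>" for c
    using that subgroup.one_closed[OF subgroup_span[OF Y]] by (simp add: span_preimage_def)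
  have ker: "c \<in> ?L" if "c \<in> carrier E" "\<pi> c = \<one>\<^bsub>Q\<^esub>" for c
    using that ker_span commutator_kernel_left[OF that x] C.one_closed by auto
  have lc: "lower_central E (Suc 0) \<subseteq> ?L"
  proof
    fix e assume e: "e \<in> lower_central E (Suc 0)"
    then have "\<pi> e \<in> lower_central Q (Suc 0)" using image_lower_central[of "Suc 0"] by blast
    then have "e \<in> span_preimage Y"
      using derived_subset_span e E.lower_central_closed by (auto simp: span_preimage_def)
    moreover have "commutator E e x \<in> ?W"
      using E.commutator_lower_central[OF e x] lower_central_subset_mutual by blast
    ultimately show "e \<in> ?L" by blast
  qed
  have pow: "y [^] m \<in> ?L" if y: "y \<in> Y" for y
  proof -
    have yE: "y \<in> carrier E" using y Y by blast
    have pow_iff: "commutator E (a [^] m) b \<in> ?W \<longleftrightarrow> commutator E a b [^] m \<in> ?W"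
      if ab: "a \<in> carrier E" "b \<in> carrier E" for a b
    proof -
      interpret D: central_commutators ?W E "carrier E" b
        using ab(2) E.subgroup_self by (rule central_commutators_mutual)
      interpret d: group_hom "E\<lparr>carrier := carrier E\<rparr>" "E Mod ?W" "\<lambda>k. ?W #>\<^bsub>E\<^esub> commutator E k b"
        by (rule D.commutator_group_hom)
      have "?W #>\<^bsub>E\<^esub> commutator E (a [^] m) b = (?W #>\<^bsub>E\<^esub> commutator E a b) [^]\<^bsub>E Mod ?W\<^esub> m"
        using d.hom_nat_pow[of a m] ab(1) by (simp flip: E.nat_pow_consistent)
      also have "\<dots> = ?W #>\<^bsub>E\<^esub> (commutator E a b [^] m)"
        using ab by (intro C.FactGroup_pow) auto
      finally have eq: "?W #>\<^bsub>E\<^esub> commutator E (a [^] m) b = ?W #>\<^bsub>E\<^esub> (commutator E a b [^] m)" .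
      have "commutator E (a [^] m) b \<in> ?W \<longleftrightarrow> ?W #>\<^bsub>E\<^esub> commutator E (a [^] m) b = ?W"
        by (rule C.coset_eq_self_iff[symmetric]) (use ab in auto)
      also have "\<dots> \<longleftrightarrow> commutator E a b [^] m \<in> ?W"
        unfolding eq by (rule C.coset_eq_self_iff) (use ab in auto)
      finally show ?thesis .
    qed
    have yA: "y \<in> span_preimage Y" using y yE image_mem_span by (simp add: span_preimage_def)
    have "commutator E (x [^] m) y \<in> ?W" using m(2) yA by (rule commutator_span_preimage_mem)
    then have "commutator E x y [^] m \<in> ?W" using pow_iff[OF x yE] by blast
    then have "inv (commutator E x y [^] m) \<in> ?W" by (rule C.m_inv_closed)
    then have "commutator E y x [^] m \<in> ?W"
      using x yE E.nat_pow_inv[of "commutator E x y" m] by (simp add: E.inv_commutator)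
    then have "commutator E (y [^] m) x \<in> ?W" using pow_iff[OF yE x] by blast
    moreover have "y [^] m \<in> span_preimage Y"
      using E.subgroup_int_pow_closed[OF subgroup_span_preimage[OF Y] yA, of "int m"] by (simp add: int_pow_int)
    ultimately show ?thesis by blast
  qed
  show ?thesis
  proof (rule coset_covered_if_image[OF subgroup_span_preimage[OF Y] L])
    show "?L \<subseteq> span_preimage Y" by blast
    show "c \<in> ?L" if "c \<in> span_preimage Y" "\<pi> c = \<one>\<^bsub>Q\<^esub>" for c using that sub by (intro ker) auto
    have piL: "subgroup (\<pi> ` ?L) Q" using L by (rule image_subgroup)
    have lcL: "lower_central Q (Suc 0) \<subseteq> \<pi> ` ?L" using lc image_lower_central[of "Suc 0"] by blast
    have "\<pi> ` Y \<union> lower_central Q (Suc 0) \<subseteq> \<pi> ` Y \<union> \<pi> ` ?L" using lcL by blast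
    then have sub': "span_mod_derived Y \<subseteq> generate Q (\<pi> ` Y \<union> \<pi> ` ?L)"
      unfolding span_mod_derived_def by (rule Q.mono_generate)
    have "z [^]\<^bsub>Q\<^esub> m \<in> \<pi> ` ?L" if z: "z \<in> \<pi> ` Y" for z
    proof -
      obtain y where y: "z = \<pi> y" "y \<in> Y" using z by blast
      then have "z [^]\<^bsub>Q\<^esub> m = \<pi> (y [^] m)" using Y \<pi>.hom_nat_pow[of y m] by auto
      then show ?thesis using pow[OF y(2)] by blast
    qed
    then have *: "finite (generate Q (\<pi> ` Y \<union> \<pi> ` ?L)) \<and>
        card (generate Q (\<pi> ` Y \<union> \<pi> ` ?L)) \<le> m ^ card (\<pi> ` Y) * card (\<pi> ` ?L)"
      using fin Y by (intro Q.card_generate_union_le[OF piL finite_subgroup[OF piL] lcL _ _ m(1)]) auto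
    have "card (span_mod_derived Y) \<le> m ^ card (\<pi> ` Y) * card (\<pi> ` ?L)"
      using * card_mono[OF _ sub'] by (meson order_trans)
    also have "\<dots> \<le> m ^ card Y * card (\<pi> ` ?L)"
      using m(1) card_image_le[OF fin, of \<pi>] by (intro mult_le_mono1 power_increasing) auto
    finally show "card (\<pi> ` span_preimage Y) \<le> m ^ card Y * card (\<pi> ` ?L)"
      unfolding image_span_preimage[OF Y] .
  qed
qed

end

lemma mutual_insert:
  assumes Y: "Y \<subseteq> carrier E" and x: "x \<in> carrier E"
  shows "mutual_commutators (insert x Y) = commutator_span E (mutual_commutators Y) (span_preimage Y) x"
proof
  interpret C: central_commutators "mutual_commutators Y" E "span_preimage Y" x
    using Y x subgroup_span_preimage[OF Y] by (rule central_commutators_mutual)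
  let ?P = "commutator_span E (mutual_commutators Y) (span_preimage Y) x"
  have P: "subgroup ?P E" by (rule C.subgroup_commutator_span)
  have YA: "y \<in> span_preimage Y" if "y \<in> Y" for y
    using that Y image_mem_span by (auto simp: span_preimage_def)
  have yx: "commutator E y x \<in> ?P" if "y \<in> Y" for y
    using YA[OF that] by (rule C.commutator_in_span)
  have xy: "commutator E x y \<in> ?P" if "y \<in> Y" for y
  proof -
    have "inv (commutator E y x) \<in> ?P" using yx[OF that] by (rule subgroup.m_inv_closed[OF P])
    then show ?thesis using that Y x E.inv_commutator[of y x] by auto
  qed
  have xx: "commutator E x x \<in> ?P"
    using x E.commutator_eq_one_iff[of x x] subgroup.one_closed[OF P] by simp
  have "commutator E a b \<in> mutual_commutators Y" if "a \<in> Y" "b \<in> Y" for a b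
    using YA that by (intro commutator_span_preimage_mem Y) auto
  then have ab: "commutator E a b \<in> ?P" if "a \<in> Y" "b \<in> Y" for a b
    using that C.subset_commutator_span by blast
  show "mutual_commutators (insert x Y) \<subseteq> ?P"
    unfolding mutual_commutators_def[of "insert x Y"]
  proof (intro E.generate_subgroup_incl P Un_least)
    show "lower_central E (Suc (Suc 0)) \<subseteq> ?P"
      using lower_central_subset_mutual[OF Y] C.subset_commutator_span by blast
    show "{commutator E a b |a b. a \<in> insert x Y \<and> b \<in> insert x Y} \<subseteq> ?P"
      using xx xy yx ab by auto
  qed
next
  have Yx: "insert x Y \<subseteq> carrier E" using assms by simp
  have "mutual_commutators Y \<subseteq> mutual_commutators (insert x Y)"
    unfolding mutual_commutators_def by (intro E.mono_generate) blast
  moreover have "commutator E k x \<in> mutual_commutators (insert x Y)" if "k \<in> span_preimage Y" for k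
  proof (rule commutator_span_preimage_mem[OF Yx])
    show "k \<in> span_preimage (insert x Y)"
      using that span_mono[of Y "insert x Y"] by (auto simp: span_preimage_def)
    show "x \<in> span_preimage (insert x Y)"
      using x image_mem_span[of x "insert x Y"] by (simp add: span_preimage_def)
  qed
  ultimately show "commutator_span E (mutual_commutators Y) (span_preimage Y) x \<subseteq> mutual_commutators (insert x Y)"
    using subgroup.m_closed[OF subgroup_mutual[OF Yx]] unfolding commutator_span_def set_mult_def by blast
qed

text \<open>Removing the element \<open>x\<close> of smallest index \<open>m\<close> leaves a set of \<open>r\<close> elements whose span has order at
  least \<open>m\<^sup>r g\<close>, where \<open>g\<close> is the order of the derived subgroup. Commutators with \<open>x\<close> contribute a
  factor \<open>m\<^sup>r\<close> to \<open>N\<close>, hence \<open>m\<^bsup>2r\<^esup>\<close> on the left of the inequality. One half of this is paid for by the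
  growth of the span by the factor \<open>m\<close>, the other half by passing from the exponent \<open>r - 1\<close> to \<open>r\<close>.\<close>

lemma mutual_commutators_covered:
  assumes "finite Y" "Y \<subseteq> carrier E"
  shows "\<exists>N. coset_covered E (mutual_commutators Y) (lower_central E (Suc (Suc 0))) N \<and>
    N\<^sup>2 * card (lower_central Q (Suc 0)) ^ (card Y - 1) \<le> card (span_mod_derived Y) ^ (card Y - 1)"
  using assms
proof (induction "card Y" arbitrary: Y)
  case 0
  then have "Y = {}" by simp
  have "coset_covered E (mutual_commutators {}) (lower_central E (Suc (Suc 0))) 1"
    using E.coset_covered_refl[OF E.subgroup_lower_central[of "Suc (Suc 0)"]]
      antisym[OF _ lower_central_subset_mutual[of "{}"]] E.generate_subgroup_incl[OF order_refl E.subgroup_lower_central[of "Suc (Suc 0)"]]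
    by (simp add: mutual_commutators_def)
  then show ?case unfolding \<open>Y = {}\<close> by (intro exI[of _ 1]) simp
next
  case (Suc r)
  let ?B = span_mod_derived and ?g = "card (lower_central Q (Suc 0))"
  define index where "index y = card (?B Y) div card (?B (Y - {y}))" for y
  have Y0: "Y \<noteq> {}" using Suc.hyps(2) by auto
  have index: "card (?B Y) = index y * card (?B (Y - {y}))" "0 < index y" if y: "y \<in> Y" for y
  proof -
    have "Y - {y} \<subseteq> carrier E" using Suc.prems(2) by blast
    then obtain m where m: "card (?B Y) = m * card (?B (Y - {y}))" "0 < m"
      by (rule Q.index_of_subgroup[OF subgroup_span[OF Suc.prems(2)] subgroup_span span_mono[OF Diff_subset] finite_span[OF Suc.prems(2)]])
    then have "index y = m" using card_span_pos[OF \<open>Y - {y} \<subseteq> carrier E\<close>] by (simp add: index_def)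
    then show "card (?B Y) = index y * card (?B (Y - {y}))" "0 < index y" using m by auto
  qed
  obtain x where x: "x \<in> Y" "\<And>y. y \<in> Y \<Longrightarrow> index x \<le> index y"
    using ex_is_arg_min_if_finite[OF Suc.prems(1) Y0, of index] by (auto simp: is_arg_min_linorder)
  define Y' where "Y' = Y - {x}"
  have Y': "finite Y'" "Y' \<subseteq> carrier E" "card Y' = r" "insert x Y' = Y" "Y' \<subseteq> Y" "x \<in> carrier E"
    using Suc.prems Suc.hyps(2) x(1) by (auto simp: Y'_def)
  define m where "m = index x"
  have m: "0 < m" "card (?B Y) = m * card (?B Y')" using index[OF x(1)] by (auto simp: m_def Y'_def)
  have "\<pi> x [^]\<^bsub>Q\<^esub> m \<in> ?B Y'"
    using m(2) image_mem_span[OF x(1)]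
    by (intro Q.pow_index_mem[OF normal_span[OF Y'(2)] subgroup_span[OF Suc.prems(2)] finite_span[OF Suc.prems(2)] span_mono[OF Y'(5)]])
  then have xm: "x [^] m \<in> span_preimage Y'"
    using Y'(6) by (simp add: span_preimage_def \<pi>.hom_nat_pow)
  interpret C: central_commutators "mutual_commutators Y'" E "span_preimage Y'" x
    using Y'(2,6) subgroup_span_preimage[OF Y'(2)] by (rule central_commutators_mutual)
  have step: "coset_covered E (mutual_commutators Y) (mutual_commutators Y') (m ^ r)"
    using C.commutator_span_covered[OF kernel_commutator_covered[OF Y'(2,1,6) m(1) xm]]
      mutual_insert[OF Y'(2,6)] Y'(3,4) by simp
  obtain N where N: "coset_covered E (mutual_commutators Y') (lower_central E (Suc (Suc 0))) N"
      "N\<^sup>2 * ?g ^ (r - 1) \<le> card (?B Y') ^ (r - 1)"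
    using Suc.hyps(1)[of Y'] Y' by auto
  have "mutual_commutators Y' \<subseteq> mutual_commutators Y"
    unfolding mutual_commutators_def using Y'(5) by (intro E.mono_generate) blast
  then have cov: "coset_covered E (mutual_commutators Y) (lower_central E (Suc (Suc 0))) (m ^ r * N)"
    using E.lower_central_closed
    by (intro E.coset_covered_trans[OF subgroup_mutual[OF Suc.prems(2)] _ _ step N(1)]) blast+
  have "m ^ r * ?g \<le> card (?B Y')"
    unfolding Y'(3)[symmetric]
  proof (rule power_le_card_span[OF Y'(1,5) Suc.prems(2)])
    fix y assume y: "y \<in> Y"
    have "m * card (?B (Y - {y})) \<le> index y * card (?B (Y - {y}))"
      using x(2)[OF y] by (intro mult_le_mono1) (simp add: m_def)
    then show "m * card (?B (Y - {y})) \<le> card (?B Y)" using index(1)[OF y] by simp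
  qed
  then have "(N\<^sup>2 * ?g ^ (r - 1)) * (m ^ r * ?g) \<le> card (?B Y') ^ (r - 1) * card (?B Y')" if "r > 0"
    using N(2) by (intro mult_le_mono)
  then have "N\<^sup>2 * m ^ r * ?g ^ r \<le> card (?B Y') ^ r"
    using N(2) by (cases r) (simp_all add: algebra_simps)
  then have "m ^ r * (N\<^sup>2 * m ^ r * ?g ^ r) \<le> m ^ r * card (?B Y') ^ r" by (rule mult_le_mono2)
  then have "(m ^ r * N)\<^sup>2 * ?g ^ r \<le> card (?B Y) ^ r"
    unfolding m(2) by (simp add: power2_eq_square power_mult_distrib ac_simps)
  moreover have "card Y - 1 = r" using Suc.hyps(2) by simp
  ultimately show ?case using cov by (intro exI[of _ "m ^ r * N"]) simp
qed

lemma mutual_commutators_full: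
  assumes A: "A \<subseteq> carrier E" "generate Q (\<pi> ` A) = carrier Q"
  shows "mutual_commutators A = lower_central E (Suc 0)" "span_mod_derived A = carrier Q"
proof -
  have "carrier Q \<subseteq> span_mod_derived A"
    unfolding span_mod_derived_def A(2)[symmetric] by (intro Q.mono_generate) blast
  then show full: "span_mod_derived A = carrier Q"
    using subgroup.subset[OF subgroup_span[OF A(1)]] by blast
  then have "commutator E a b \<in> mutual_commutators A" if "a \<in> carrier E" "b \<in> carrier E" for a b
    using that by (intro commutator_span_preimage_mem[OF A(1)]) (auto simp: span_preimage_def)
  then have "lower_central E (Suc 0) \<subseteq> mutual_commutators A"
    by (intro E.lower_central_Suc_minimal subgroup_mutual A(1)) auto
  then show "mutual_commutators A = lower_central E (Suc 0)"
    using mutual_subset_lower_central[OF A(1)] by blast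
qed

end

section \<open>The derived subgroup of a central extension\<close>

lemma (in group) card_subgroup_prime_power:
  assumes "Factorial_Ring.prime (p :: nat)" "order G = p ^ n" "subgroup H G"
  obtains e where "card H = p ^ e"
proof -
  have "card H dvd p ^ n" using lagrange[OF assms(3)] assms(2) by (metis dvd_triv_right)
  then show ?thesis using that divides_primepow_nat[OF assms(1)] by auto
qed

context central_extension
begin

lemma lower_central_stable:
  assumes "lower_central Q (Suc i) = lower_central Q i" "i \<le> j"
  shows "lower_central Q j = lower_central Q i"
  using assms(2)
proof (induction rule: dec_induct)
  case (step j)
  then have "lower_central Q (Suc j) = lower_central Q (Suc i)" by (simp add: lower_central.simps)
  then show ?case using assms(1) by simp
qed simp

text \<open>Otherwise all left-normed commutators of this weight, and then the whole term of the series, would be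
  contained in the next term.\<close>

lemma ex_left_normed_not_in_next:
  assumes A: "A \<subseteq> carrier E" "generate Q (\<pi> ` A) = carrier Q"
    and ne: "lower_central Q (Suc i) \<noteq> lower_central Q i"
  obtains x ys where "x \<in> A" "set ys \<subseteq> A" "length ys = i"
    "\<pi> (foldl (commutator E) x ys) \<notin> lower_central Q (Suc i)"
proof (rule ccontr)
  assume contr: "\<not> thesis"
  have "lower_central Q i \<subseteq> lower_central Q (Suc i)"
  proof (rule Q.lower_central_subset_if_left_normed)
    show "\<pi> ` A \<subseteq> carrier Q" "generate Q (\<pi> ` A) = carrier Q" using A by auto
    show "lower_central Q (Suc i) \<subseteq> lower_central Q i" by (rule Q.lower_central_Suc_subset)
    fix x' ys' assume *: "x' \<in> \<pi> ` A" "set ys' \<subseteq> \<pi> ` A" "length ys' = i"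
    define s where "s = inv_into A \<pi>"
    have s: "s z \<in> A" "\<pi> (s z) = z" if "z \<in> \<pi> ` A" for z
      using that by (simp_all add: s_def inv_into_into f_inv_into_f)
    have sA: "set (map s ys') \<subseteq> A" using * s by auto
    have "\<pi> (foldl (commutator E) (s x') (map s ys')) \<in> lower_central Q (Suc i)"
      using contr that[of "s x'" "map s ys'"] s(1)[OF *(1)] sA *(3) by auto
    moreover have "map \<pi> (map s ys') = ys'"
      using *(2) s(2) by (auto intro!: map_idI)
    moreover have "\<pi> (foldl (commutator E) (s x') (map s ys')) = foldl (commutator Q) (\<pi> (s x')) (map \<pi> (map s ys'))"
      using s(1)[OF *(1)] sA A(1) by (intro \<pi>.hom_left_normed) auto
    ultimately show "foldl (commutator Q) x' ys' \<in> lower_central Q (Suc i)"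
      using s(2)[OF *(1)] by simp
  qed (auto simp only: Q.subgroup_lower_central)
  then show False using ne Q.lower_central_Suc_subset by blast
qed

text \<open>The generators in \<open>S\<close>, which occur in the commutator \<open>u\<close>, cost a factor \<open>p\<^bsup>a-b\<^esup>\<close> each.
  For every other generator \<open>z\<close> the element \<open>u\<close> lies in the kernel of \<open>v \<mapsto> [v, z]\<close> modulo the
  layer of \<open>S\<close>; as \<open>u\<close> is nontrivial modulo the next term of the series of \<open>Q\<close>, the kernel is larger
  by a factor \<open>p\<close>. In terms of weights, \<open>u\<close> has weight \<open>i + 1\<close>, whence the \<open>Suc i\<close> in the exponent.\<close>

lemma higher_layer_covered:
  assumes p: "Factorial_Ring.prime (p :: nat)" "order Q = p ^ n"
    and A: "finite A" "A \<subseteq> carrier E" "generate Q (\<pi> ` A) = carrier Q"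
    and card: "card (lower_central Q i) = p ^ a" "card (lower_central Q (Suc i)) = p ^ b"
    and ne: "lower_central Q (Suc i) \<noteq> lower_central Q i"
  shows "b < a" "coset_covered E (lower_central E (Suc i)) (lower_central E (Suc (Suc i)))
    (p ^ (card A * (a - b) - (card A - Suc i)))"
proof -
  have p1: "1 < p" using p(1) prime_gt_1_nat by blast
  have "lower_central Q (Suc i) \<subset> lower_central Q i"
    using ne Q.lower_central_Suc_subset by blast
  then have "p ^ b < p ^ a"
    using psubset_card_mono[OF finite_subgroup[OF Q.subgroup_lower_central]] card by metis
  then show ba: "b < a" using p1 by simp
  obtain x ys where xys: "x \<in> A" "set ys \<subseteq> A" "length ys = i"
      "\<pi> (foldl (commutator E) x ys) \<notin> lower_central Q (Suc i)"
    by (rule ex_left_normed_not_in_next[OF A(2,3) ne])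
  define u where "u = foldl (commutator E) x ys"
  define S where "S = set (x # ys)"
  define Z where "Z = A - S"
  have S: "finite S" "S \<subseteq> A" "S \<subseteq> carrier E" "card S \<le> Suc i"
    using xys A(2) card_length[of "x # ys"] by (auto simp: S_def)
  have Z: "finite Z" "Z \<subseteq> carrier E" "S \<union> Z = A" "card S + card Z = card A"
    using A S card_Diff_subset[of S A] card_mono[of A S] by (auto simp: Z_def)
  interpret LS: normal "layer_subgroup i S" E using S(3) by (rule normal_layer)
  have next_sub: "lower_central E (Suc i) \<subseteq> {k \<in> lower_central E i. commutator E k z \<in> layer_subgroup i J}"
    if "z \<in> carrier E" "J \<subseteq> carrier E" for z J
    using that E.lower_central_Suc_subset[of i] E.commutator_lower_central[of _ "Suc i" z]
      lower_central_subset_layer[OF that(2), of i] by blast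
  have 1: "coset_covered E (layer_subgroup i ({} \<union> S)) (layer_subgroup i {}) ((p ^ (a - b)) ^ card S)"
  proof (rule layer_extend_covered[OF S(1,3)])
    fix z assume z: "z \<in> S"
    let ?K = "{k \<in> lower_central E i. commutator E k z \<in> layer_subgroup i {}}"
    have zE: "z \<in> carrier E" using z S by blast
    have "lower_central Q (Suc i) \<subseteq> \<pi> ` ?K"
      using next_sub[OF zE, of "{}"] image_lower_central[of "Suc i"] by blast
    moreover have "\<pi> ` ?K \<subseteq> lower_central Q i" using image_lower_central[of i] by blast
    then have "finite (\<pi> ` ?K)"
      using finite_subgroup[OF Q.subgroup_lower_central[of i]] by (rule finite_subset)
    ultimately have "p ^ b \<le> card (\<pi> ` ?K)" unfolding card(2)[symmetric] by (rule card_mono[rotated])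
    then have "p ^ (a - b) * p ^ b \<le> p ^ (a - b) * card (\<pi> ` ?K)" by (rule mult_le_mono2)
    then show "card (lower_central Q i) \<le> p ^ (a - b) * card (\<pi> ` ?K)"
      using ba card(1) by (simp flip: power_add)
  qed simp
  have 2: "coset_covered E (layer_subgroup i (S \<union> Z)) (layer_subgroup i S) ((p ^ (a - b - 1)) ^ card Z)"
  proof (rule layer_extend_covered[OF Z(1,2) S(3)])
    fix z assume z: "z \<in> Z"
    let ?K = "{k \<in> lower_central E i. commutator E k z \<in> layer_subgroup i S}"
    have zE: "z \<in> carrier E" using z Z by blast
    interpret C: central_commutators "layer_subgroup i S" E "lower_central E i" z
      using S(3) zE by (rule central_commutators_layer)
    have sub: "subgroup (\<pi> ` ?K) Q" using C.subgroup_kernel_commutator by (rule image_subgroup)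
    obtain e where e: "card (\<pi> ` ?K) = p ^ e"
      using Q.card_subgroup_prime_power[OF p sub] .
    \<comment> \<open>The Jacobi identity, applied to z as an element of the whole group (s = 0).\<close>
    have "commutator E z u \<in> layer_subgroup i S" unfolding u_def
    proof (rule LS.commutator_left_normed_mem[where s = 0])
      show "lower_central E (Suc (Suc (length ys + 0))) \<subseteq> layer_subgroup i S"
        using lower_central_subset_layer[OF S(3), of i] xys(3) by simp
      show "commutator E v z \<in> layer_subgroup i S" if "v \<in> lower_central E (length ys + 0)" "z \<in> S" for v z
        using that xys(3) commutator_mem_layer[OF S(3)] by simp
      show "z \<in> lower_central E 0" using zE by simp
    qed (use S in \<open>auto simp: S_def\<close>)
    moreover have u: "u \<in> lower_central E i" "u \<in> carrier E"
      using E.left_normed_in_lower_central[of x ys] E.left_normed_closed[of x ys] xys A(2) by (auto simp: u_def)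
    ultimately have "u \<in> ?K" using LS.commutator_mem_swap[of u z] zE by blast
    moreover have "\<pi> u \<notin> lower_central Q (Suc i)" using xys(4) by (simp add: u_def)
    moreover have "lower_central Q (Suc i) \<subseteq> \<pi> ` ?K"
      using next_sub[OF zE S(3)] image_lower_central[of "Suc i"] by blast
    ultimately have "lower_central Q (Suc i) \<subset> \<pi> ` ?K" by blast
    then have "p ^ b < p ^ e"
      using psubset_card_mono[OF finite_subgroup[OF sub]] card(2) e by metis
    then have "b < e" using p1 by simp
    \<comment> \<open>Both orders are powers of p, so the strict inclusion gains a full factor p.\<close>
    then have "p ^ a \<le> p ^ (a - b - 1 + e)" using p1 by (intro power_increasing) auto
    then show "card (lower_central Q i) \<le> p ^ (a - b - 1) * card (\<pi> ` ?K)"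
      unfolding card(1) e by (simp add: power_add)
  qed
  have "coset_covered E (layer_subgroup i A) (layer_subgroup i {}) ((p ^ (a - b - 1)) ^ card Z * (p ^ (a - b)) ^ card S)"
    using 1 2 Z(3) subgroup_layer A(2) S(2) subgroup.subset[OF subgroup_layer[of "{}" i]]
    by (intro E.coset_covered_trans[where S = "layer_subgroup i S"] layer_mono) auto
  moreover have "(p ^ (a - b - 1)) ^ card Z * (p ^ (a - b)) ^ card S \<le> p ^ (card A * (a - b) - (card A - Suc i))"
  proof -
    have "(a - b - 1) * card Z + (a - b) * card S + card Z = card A * (a - b)"
      using ba unfolding Z(4)[symmetric] by (cases "a - b") (auto simp: algebra_simps)
    moreover have "card A - Suc i \<le> card Z" using Z(4) S(4) by simp
    ultimately have "(a - b - 1) * card Z + (a - b) * card S \<le> card A * (a - b) - (card A - Suc i)"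
      by simp
    then show ?thesis using p1 power_increasing[of _ _ p] by (simp flip: power_mult power_add)
  qed
  ultimately show "coset_covered E (lower_central E (Suc i)) (lower_central E (Suc (Suc i)))
    (p ^ (card A * (a - b) - (card A - Suc i)))"
    unfolding layer_full[OF A(2,3)] layer_empty by (rule coset_covered_mono)
qed

text \<open>The number \<open>N\<close> bounds the top layer and \<open>p\<^sup>e\<close> the product of all others. The exponents of the layers
  add up to \<open>dk\<close> minus the savings since the orders of the factors \<open>\<gamma>\<^sub>i(Q)/\<gamma>\<^sub>i\<^sub>+\<^sub>1(Q)\<close> with \<open>i \<ge> 2\<close> multiply
  to \<open>p\<^sup>k\<close>. Savings are written with truncated subtraction: layers beyond weight \<open>card A\<close> save nothing.\<close>

theorem card_derived_le:
  assumes p: "Factorial_Ring.prime (p :: nat)" "order Q = p ^ n"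
    and A: "finite A" "A \<subseteq> carrier E" "generate Q (\<pi> ` A) = carrier Q"
    and c: "has_nilpotency_class Q c" "1 \<le> c"
    and k: "card (lower_central Q (Suc 0)) = p ^ k"
  obtains N e where "finite (lower_central E (Suc 0))" "card (lower_central E (Suc 0)) \<le> N * p ^ e"
    "N\<^sup>2 * p ^ (k * (card A - 1)) \<le> p ^ (n * (card A - 1))"
    "e + (\<Sum>i = 2..min (card A) c. card A - i) = card A * k"
proof -
  let ?d = "card A"
  have p1: "1 < p" using p(1) prime_gt_1_nat by blast
  have "\<forall>i. \<exists>e. card (lower_central Q i) = p ^ e"
    using Q.card_subgroup_prime_power[OF p Q.subgroup_lower_central] by blast
  from choice[OF this] obtain a where a: "card (lower_central Q i) = p ^ a i" for i by blast
  have a1: "a 1 = k" using a[of "Suc 0"] k p1 by simp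
  have "p ^ a c = p ^ 0" unfolding a[of c, symmetric] using c(1) by (simp add: has_nilpotency_class_def)
  then have ac: "a c = 0" by (simp only: power_inject_exp[OF p1])
  have ne: "lower_central Q (Suc i) \<noteq> lower_central Q i" if "i < c" for i
    using lower_central_stable[of i c] that c(1) by (auto simp: has_nilpotency_class_def)
  obtain N where N: "coset_covered E (lower_central E (Suc 0)) (lower_central E (Suc (Suc 0))) N"
      "N\<^sup>2 * card (lower_central Q (Suc 0)) ^ (?d - 1) \<le> card (carrier Q) ^ (?d - 1)"
    using mutual_commutators_covered[OF A(1,2)] unfolding mutual_commutators_full[OF A(2,3)] by blast
  have "\<exists>e. coset_covered E (lower_central E (Suc 0)) (lower_central E (Suc j)) (N * p ^ e) \<and>
      e + (\<Sum>i = 1..<j. ?d - Suc i) + ?d * a j = ?d * k" if "1 \<le> j" "j \<le> c" for j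
    using that
  proof (induction j rule: nat_induct_at_least)
    case base
    then show ?case using N(1) a1 by (intro exI[of _ 0]) simp
  next
    case (Suc j)
    then obtain e where e: "coset_covered E (lower_central E (Suc 0)) (lower_central E (Suc j)) (N * p ^ e)"
      "e + (\<Sum>i = 1..<j. ?d - Suc i) + ?d * a j = ?d * k" by auto
    let ?f = "?d * (a j - a (Suc j)) - (?d - Suc j)"
    have step: "a (Suc j) < a j"
        "coset_covered E (lower_central E (Suc j)) (lower_central E (Suc (Suc j))) (p ^ ?f)"
      using Suc.prems by (intro higher_layer_covered[OF p A a a ne]; simp)+
    have "coset_covered E (lower_central E (Suc 0)) (lower_central E (Suc (Suc j))) (N * p ^ e * p ^ ?f)"
      using E.lower_central_antimono[of "Suc 0" "Suc j"] subgroup.subset[OF E.subgroup_lower_central]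
      by (intro E.coset_covered_trans[OF E.subgroup_lower_central _ _ e(1) step(2)]) simp_all
    then have "coset_covered E (lower_central E (Suc 0)) (lower_central E (Suc (Suc j))) (N * p ^ (e + ?f))"
      by (simp add: power_add mult.assoc)
    moreover have "e + ?f + (\<Sum>i = 1..<Suc j. ?d - Suc i) + ?d * a (Suc j) = ?d * k"
    proof -
      have "?d * 1 \<le> ?d * (a j - a (Suc j))" using step(1) by (intro mult_le_mono2) simp
      then have "?f + (?d - Suc j) = ?d * (a j - a (Suc j))" by linarith
      moreover have "?d * (a j - a (Suc j)) + ?d * a (Suc j) = ?d * a j"
        using step(1) by (simp flip: distrib_left)
      ultimately show ?thesis using e(2) Suc.hyps by simp
    qed
    ultimately show ?case by blast
  qed
  from this[of c] obtain e where
    e: "coset_covered E (lower_central E (Suc 0)) (lower_central E (Suc c)) (N * p ^ e)"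
      "e + (\<Sum>i = 1..<c. ?d - Suc i) = ?d * k" using c(2) ac by auto
  \<comment> \<open>The term that maps to the trivial group is central, so the next term vanishes.\<close>
  have "lower_central E (Suc c) \<subseteq> {\<one>}"
  proof (rule E.lower_central_Suc_minimal[OF E.triv_subgroup])
    fix x g assume x: "x \<in> lower_central E c" and g: "g \<in> carrier E"
    have "\<pi> x \<in> lower_central Q c" using x image_lower_central[of c] by blast
    then have "\<pi> x = \<one>\<^bsub>Q\<^esub>" using c(1) by (simp add: has_nilpotency_class_def)
    then show "commutator E x g \<in> {\<one>}" using commutator_kernel_left E.lower_central_closed[OF x] g by simp
  qed
  then have "lower_central E (Suc c) = {\<one>}"
    using subgroup.one_closed[OF E.subgroup_lower_central[of "Suc c"]] by blast
  then have cov: "coset_covered E (lower_central E (Suc 0)) {\<one>} (N * p ^ e)" using e(1) by simp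
  have "(\<Sum>i = 1..<c. ?d - Suc i) = (\<Sum>i = 2..<Suc c. ?d - i)"
    using sum.shift_bounds_Suc_ivl[of "\<lambda>i. ?d - i" 1 c] by (simp add: numeral_2_eq_2)
  also have "\<dots> = (\<Sum>i = 2..min ?d c. ?d - i)"
    by (rule sum.mono_neutral_right) auto
  finally have "e + (\<Sum>i = 2..min ?d c. ?d - i) = ?d * k" using e(2) by simp
  moreover have "N\<^sup>2 * p ^ (k * (?d - 1)) \<le> p ^ (n * (?d - 1))"
    using N(2) p(2) unfolding k by (simp add: order_def power_mult)
  moreover have "lower_central E (Suc 0) \<subseteq> carrier E" using E.lower_central_closed by blast
  ultimately show ?thesis
    using that E.coset_covered_one_imp_card_le[OF cov] by blast
qed

end

text \<open>The derived subgroup of \<open>E\<close> maps onto that of \<open>Q\<close>, and \<open>H\<close> lies in the kernel.\<close>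

lemma (in central_extension) card_central_mult_card_derived_le:
  assumes fin: "finite (lower_central E (Suc 0))"
    and H: "H \<subseteq> lower_central E (Suc 0)" "\<And>c. c \<in> H \<Longrightarrow> \<pi> c = \<one>\<^bsub>Q\<^esub>"
  shows "card H * card (lower_central Q (Suc 0)) \<le> card (lower_central E (Suc 0))"
proof -
  let ?D = "lower_central E (Suc 0)"
  define \<sigma> where "\<sigma> = inv_into ?D \<pi>"
  have \<sigma>: "\<sigma> g \<in> ?D" "\<pi> (\<sigma> g) = g" "\<sigma> g \<in> carrier E" if "g \<in> lower_central Q (Suc 0)" for g
  proof -
    have "g \<in> \<pi> ` ?D" using that image_lower_central[of "Suc 0"] by simp
    then show "\<sigma> g \<in> ?D" "\<pi> (\<sigma> g) = g" "\<sigma> g \<in> carrier E"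
      using E.lower_central_closed[of "\<sigma> g" "Suc 0"]
      by (auto simp: \<sigma>_def inv_into_into f_inv_into_f)
  qed
  have cE: "c \<in> carrier E" if "c \<in> H" for c using H(1) that E.lower_central_closed by blast
  let ?f = "\<lambda>(c, g). c \<otimes> \<sigma> g"
  have "inj_on ?f (H \<times> lower_central Q (Suc 0))"
  proof (rule inj_onI, clarify)
    fix c g c' g' assume *: "c \<in> H" "g \<in> lower_central Q (Suc 0)" "c' \<in> H" "g' \<in> lower_central Q (Suc 0)"
      and eq: "c \<otimes> \<sigma> g = c' \<otimes> \<sigma> g'"
    have "\<pi> (c \<otimes> \<sigma> g) = \<pi> (c' \<otimes> \<sigma> g')" using eq by simp
    then have "g = g'" using * \<sigma> H(2) cE Q.lower_central_closed by simp
    then show "c = c' \<and> g = g'" using eq * \<sigma>(3) cE by simp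
  qed
  then have "card (?f ` (H \<times> lower_central Q (Suc 0))) = card H * card (lower_central Q (Suc 0))"
    by (simp add: card_image card_cartesian_product)
  moreover have "?f ` (H \<times> lower_central Q (Suc 0)) \<subseteq> ?D"
    using H(1) \<sigma>(1) subgroup.m_closed[OF E.subgroup_lower_central[of "Suc 0"]] by auto
  ultimately show ?thesis using card_mono[OF fin] by metis
qed

section \<open>Extensions defined by cocycles\<close>

text \<open>The unit corrects for the value of the cocycle at \<open>(1, 1)\<close>, which need not be trivial.\<close>

definition cocycle_extension ::
    "('c, 'd) monoid_scheme \<Rightarrow> ('a, 'b) monoid_scheme \<Rightarrow> ('a \<Rightarrow> 'a \<Rightarrow> 'c) \<Rightarrow> ('c \<times> 'a) monoid"
  where "cocycle_extension A G f = \<lparr>carrier = carrier A \<times> carrier G,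
    monoid.mult = (\<lambda>(a, g) (b, h). (a \<otimes>\<^bsub>A\<^esub> b \<otimes>\<^bsub>A\<^esub> f g h, g \<otimes>\<^bsub>G\<^esub> h)),
    one = (inv\<^bsub>A\<^esub> f \<one>\<^bsub>G\<^esub> \<one>\<^bsub>G\<^esub>, \<one>\<^bsub>G\<^esub>)\<rparr>"

locale two_cocycle = A: comm_group A + G: group G
  for A (structure) and G (structure) +
  fixes f
  assumes f_closed [simp, intro]: "\<lbrakk>g \<in> carrier G; h \<in> carrier G\<rbrakk> \<Longrightarrow> f g h \<in> carrier A"
    and cocycle: "\<lbrakk>g \<in> carrier G; h \<in> carrier G; k \<in> carrier G\<rbrakk> \<Longrightarrow>
      f h k \<otimes>\<^bsub>A\<^esub> f g (h \<otimes>\<^bsub>G\<^esub> k) = f (g \<otimes>\<^bsub>G\<^esub> h) k \<otimes>\<^bsub>A\<^esub> f g h"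
begin

abbreviation "E \<equiv> cocycle_extension A G f"

lemma extension_simps:
  "carrier E = carrier A \<times> carrier G"
  "(a, g) \<otimes>\<^bsub>E\<^esub> (b, h) = (a \<otimes>\<^bsub>A\<^esub> b \<otimes>\<^bsub>A\<^esub> f g h, g \<otimes>\<^bsub>G\<^esub> h)"
  "\<one>\<^bsub>E\<^esub> = (inv\<^bsub>A\<^esub> f \<one>\<^bsub>G\<^esub> \<one>\<^bsub>G\<^esub>, \<one>\<^bsub>G\<^esub>)"
  by (simp_all add: cocycle_extension_def)

lemma cocycle_one_left: 
  assumes "g \<in> carrier G" shows "f \<one>\<^bsub>G\<^esub> g = f \<one>\<^bsub>G\<^esub> \<one>\<^bsub>G\<^esub>"
  using cocycle[of "\<one>\<^bsub>G\<^esub>" "\<one>\<^bsub>G\<^esub>" g] assms by simp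

lemma cocycle_one_right: 
  assumes "g \<in> carrier G" shows "f g \<one>\<^bsub>G\<^esub> = f \<one>\<^bsub>G\<^esub> \<one>\<^bsub>G\<^esub>"
  using cocycle[of g "\<one>\<^bsub>G\<^esub>" "\<one>\<^bsub>G\<^esub>"] assms by simp

lemma A_cancel: "\<lbrakk>a \<in> carrier A; b \<in> carrier A\<rbrakk> \<Longrightarrow> inv\<^bsub>A\<^esub> a \<otimes>\<^bsub>A\<^esub> (b \<otimes>\<^bsub>A\<^esub> a) = b"
  by (simp add: A.m_lcomm)

lemma group_extension: "group E"
proof (rule groupI)
  show "\<one>\<^bsub>E\<^esub> \<in> carrier E" by (simp add: extension_simps)
  show "x \<otimes>\<^bsub>E\<^esub> y \<in> carrier E" if "x \<in> carrier E" "y \<in> carrier E" for x y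
    using that by (auto simp: extension_simps)
  show "x \<otimes>\<^bsub>E\<^esub> y \<otimes>\<^bsub>E\<^esub> z = x \<otimes>\<^bsub>E\<^esub> (y \<otimes>\<^bsub>E\<^esub> z)"
    if xyz: "x \<in> carrier E" "y \<in> carrier E" "z \<in> carrier E" for x y z
  proof -
    obtain a g b h c k where [simp]: "x = (a, g)" "y = (b, h)" "z = (c, k)" by (cases x, cases y, cases z)
    have cl [simp]: "a \<in> carrier A" "b \<in> carrier A" "c \<in> carrier A" "g \<in> carrier G" "h \<in> carrier G" "k \<in> carrier G"
      using xyz by (auto simp: extension_simps)
    have "a \<otimes>\<^bsub>A\<^esub> b \<otimes>\<^bsub>A\<^esub> f g h \<otimes>\<^bsub>A\<^esub> c \<otimes>\<^bsub>A\<^esub> f (g \<otimes>\<^bsub>G\<^esub> h) k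
        = a \<otimes>\<^bsub>A\<^esub> b \<otimes>\<^bsub>A\<^esub> c \<otimes>\<^bsub>A\<^esub> (f (g \<otimes>\<^bsub>G\<^esub> h) k \<otimes>\<^bsub>A\<^esub> f g h)"
      by (simp add: A.m_ac)
    also have "\<dots> = a \<otimes>\<^bsub>A\<^esub> (b \<otimes>\<^bsub>A\<^esub> c \<otimes>\<^bsub>A\<^esub> f h k) \<otimes>\<^bsub>A\<^esub> f g (h \<otimes>\<^bsub>G\<^esub> k)"
      unfolding cocycle[OF cl(4-6), symmetric] by (simp add: A.m_assoc)
    finally show ?thesis by (simp add: extension_simps G.m_assoc)
  qed
  show "\<one>\<^bsub>E\<^esub> \<otimes>\<^bsub>E\<^esub> x = x" if xE: "x \<in> carrier E" for x
  proof -
    obtain a g where x: "x = (a, g)" "a \<in> carrier A" "g \<in> carrier G" using xE by (auto simp: extension_simps)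
    then show ?thesis
      unfolding x(1) extension_simps cocycle_one_left[OF x(3)] by (simp add: A.m_assoc A_cancel)
  qed
  show "\<exists>y\<in>carrier E. y \<otimes>\<^bsub>E\<^esub> x = \<one>\<^bsub>E\<^esub>" if xE: "x \<in> carrier E" for x
  proof -
    obtain a g where x: "x = (a, g)" "a \<in> carrier A" "g \<in> carrier G" using xE by (auto simp: extension_simps)
    let ?y = "(inv\<^bsub>A\<^esub> f \<one>\<^bsub>G\<^esub> \<one>\<^bsub>G\<^esub> \<otimes>\<^bsub>A\<^esub> inv\<^bsub>A\<^esub> (a \<otimes>\<^bsub>A\<^esub> f (inv\<^bsub>G\<^esub> g) g), inv\<^bsub>G\<^esub> g)"
    have "?y \<otimes>\<^bsub>E\<^esub> x = \<one>\<^bsub>E\<^esub>"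
      using x by (simp add: extension_simps A.m_assoc)
    moreover have "?y \<in> carrier E" using x by (simp add: extension_simps)
    ultimately show ?thesis by blast
  qed
qed

text \<open>The correction by the value at \<open>(1, 1)\<close> makes the inclusion of the kernel multiplicative.\<close>

definition incl :: "'a \<Rightarrow> 'a \<times> 'c"
  where "incl a = (a \<otimes>\<^bsub>A\<^esub> inv\<^bsub>A\<^esub> f \<one>\<^bsub>G\<^esub> \<one>\<^bsub>G\<^esub>, \<one>\<^bsub>G\<^esub>)"

lemma incl_closed [simp]: "a \<in> carrier A \<Longrightarrow> incl a \<in> carrier E"
  by (simp add: incl_def extension_simps)

lemma incl_mult:
  assumes "a \<in> carrier A" "b \<in> carrier A" "g \<in> carrier G"
  shows "incl a \<otimes>\<^bsub>E\<^esub> (b, g) = (a \<otimes>\<^bsub>A\<^esub> b, g)"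
  unfolding incl_def extension_simps cocycle_one_left[OF assms(3)]
  using assms by (simp add: A.m_assoc A_cancel)

lemma incl_hom: "incl \<in> hom A E"
proof (rule homI)
  show "incl (a \<otimes>\<^bsub>A\<^esub> b) = incl a \<otimes>\<^bsub>E\<^esub> incl b" if "a \<in> carrier A" "b \<in> carrier A" for a b
    using that incl_mult[of a "b \<otimes>\<^bsub>A\<^esub> inv\<^bsub>A\<^esub> f \<one>\<^bsub>G\<^esub> \<one>\<^bsub>G\<^esub>" "\<one>\<^bsub>G\<^esub>"] by (simp add: incl_def[of b] incl_def[of "a \<otimes>\<^bsub>A\<^esub> b"] A.m_assoc)
qed simp

lemma inj_incl: "inj_on incl (carrier A)"
  by (rule inj_onI) (simp add: incl_def)

lemma central_extension:
  assumes "finite (carrier G)"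
  shows "central_extension E G snd"
proof (intro central_extension.intro group_extension G.is_group central_extension_axioms.intro assms)
  show "snd \<in> hom E G" by (rule homI) (auto simp: extension_simps)
  show "snd ` carrier E = carrier G" by (force simp: extension_simps)
  fix c x assume "c \<in> carrier E" "snd c = \<one>\<^bsub>G\<^esub>" "x \<in> carrier E"
  then obtain a b g where *: "c = (a, \<one>\<^bsub>G\<^esub>)" "x = (b, g)" "a \<in> carrier A" "b \<in> carrier A" "g \<in> carrier G"
    by (auto simp: extension_simps)
  show "c \<otimes>\<^bsub>E\<^esub> x = x \<otimes>\<^bsub>E\<^esub> c"
    unfolding *(1,2) extension_simps cocycle_one_left[OF *(5)] cocycle_one_right[OF *(5)]
    using *(3-5) by (simp add: A.m_comm)
qed

text \<open>The cocycle measures the failure of \<open>g \<mapsto> (1, g)\<close> to be multiplicative.\<close>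

lemma section_mult:
  assumes "g \<in> carrier G" "h \<in> carrier G"
  shows "(\<one>\<^bsub>A\<^esub>, g) \<otimes>\<^bsub>E\<^esub> (\<one>\<^bsub>A\<^esub>, h) = incl (f g h) \<otimes>\<^bsub>E\<^esub> (\<one>\<^bsub>A\<^esub>, g \<otimes>\<^bsub>G\<^esub> h)"
  using assms incl_mult[of "f g h" "\<one>\<^bsub>A\<^esub>" "g \<otimes>\<^bsub>G\<^esub> h"] by (simp add: extension_simps)

end

section \<open>The bar complex\<close>

lemma hom_frag_extend:
  assumes "\<And>x. x \<in> S \<Longrightarrow> Poly_Mapping.keys (b x) \<subseteq> T"
  shows "frag_extend b \<in> hom (free_Abelian_group S) (free_Abelian_group T)"
proof (rule homI)
  fix x assume "x \<in> carrier (free_Abelian_group S)"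
  then show "frag_extend b x \<in> carrier (free_Abelian_group T)"
    using keys_frag_extend[of b x] assms unfolding carrier_free_Abelian_group_iff by blast
qed (simp add: frag_extend_add)

lemma hom_free_Abelian_group_eqI:
  assumes "group H" "h \<in> hom (free_Abelian_group S) H" "h' \<in> hom (free_Abelian_group S) H"
    and eq: "\<And>x. x \<in> S \<Longrightarrow> h (frag_of x) = h' (frag_of x)"
    and "Poly_Mapping.keys z \<subseteq> S"
  shows "h z = h' z"
proof -
  interpret h: group_hom "free_Abelian_group S" H h
    using assms by (simp add: group_hom_def group_hom_axioms_def)
  interpret h': group_hom "free_Abelian_group S" H h'
    using assms by (simp add: group_hom_def group_hom_axioms_def)
  show ?thesis
  proof (rule free_Abelian_group_induct[where P = "\<lambda>z. h z = h' z", OF assms(5)])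
    show "h 0 = h' 0" using h.hom_one h'.hom_one by simp
  next
    fix x y assume xy: "Poly_Mapping.keys x \<subseteq> S" "Poly_Mapping.keys y \<subseteq> S" "h x = h' x" "h y = h' y"
    have "x - y = x \<otimes>\<^bsub>free_Abelian_group S\<^esub> inv\<^bsub>free_Abelian_group S\<^esub> y" using xy(2) by simp
    moreover have "x \<in> carrier (free_Abelian_group S)" "y \<in> carrier (free_Abelian_group S)"
      using xy by auto
    ultimately show "h (x - y) = h' (x - y)"
      by (simp only: h.hom_mult h'.hom_mult h.hom_inv h'.hom_inv h.G.inv_closed xy(3,4))
  qed (rule eq)
qed

context group
begin

lemma bar_boundary2_hom: "bar_boundary2 G \<in> hom (bar_chain2 G) (bar_chain1 G)"
  unfolding bar_boundary2_def bar_chain2_def bar_chain1_def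
proof (rule hom_frag_extend, clarify)
  fix g h x assume "g \<in> carrier G" "h \<in> carrier G" "x \<in> Poly_Mapping.keys (frag_of h - frag_of (g \<otimes> h) + frag_of g)"
  then show "x \<in> carrier G" using keys_add keys_diff by (fastforce dest!: subsetD[OF keys_add] subsetD[OF keys_diff])
qed

lemma bar_boundary3_hom: "bar_boundary3 G \<in> hom (bar_chain3 G) (bar_chain2 G)"
  unfolding bar_boundary3_def bar_chain3_def bar_chain2_def
proof (rule hom_frag_extend, goal_cases)
  case (1 x)
  then obtain g h k where [simp]: "x = (g, h, k)" "g \<in> carrier G" "h \<in> carrier G" "k \<in> carrier G" by auto
  show ?case by (auto dest!: subsetD[OF keys_add] subsetD[OF keys_diff])
qed

lemma comm_group_bar_chain2: "comm_group (bar_chain2 G)"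
  unfolding bar_chain2_def by (rule abelian_free_Abelian_group)

abbreviation "bar_boundaries \<equiv> bar_boundary3 G ` carrier (bar_chain3 G)"

abbreviation "bar_cocycle g h \<equiv> bar_boundaries #>\<^bsub>bar_chain2 G\<^esub> frag_of (g, h)"

lemma subgroup_bar_boundaries: "subgroup bar_boundaries (bar_chain2 G)"
proof -
  interpret d: group_hom "bar_chain3 G" "bar_chain2 G" "bar_boundary3 G"
    using bar_boundary3_hom by (simp add: group_hom_def group_hom_axioms_def bar_chain2_def bar_chain3_def)
  show ?thesis by (rule d.img_is_subgroup)
qed

lemma frag_of_pair_closed: "g \<in> carrier G \<Longrightarrow> h \<in> carrier G \<Longrightarrow> frag_of (g, h) \<in> carrier (bar_chain2 G)"
  by (simp add: bar_chain2_def)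

text \<open>The cocycle condition modulo boundaries is the formula for the boundary of \<open>[g|h|k]\<close>.\<close>

lemma two_cocycle_bar: "two_cocycle (bar_chain2 G Mod bar_boundaries) G bar_cocycle"
proof -
  interpret C: comm_group "bar_chain2 G" by (rule comm_group_bar_chain2)
  interpret B: normal bar_boundaries "bar_chain2 G"
    using C.subgroup_imp_normal subgroup_bar_boundaries by blast
  interpret q: group_hom "bar_chain2 G" "bar_chain2 G Mod bar_boundaries" "(#>\<^bsub>bar_chain2 G\<^esub>) bar_boundaries"
    by (rule B.group_hom_quotient)
  show ?thesis
  proof (intro two_cocycle.intro two_cocycle_axioms.intro is_group C.abelian_FactGroup subgroup_bar_boundaries)
    show "bar_cocycle g h \<in> carrier (bar_chain2 G Mod bar_boundaries)" if "g \<in> carrier G" "h \<in> carrier G" for g h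
      using that by (intro q.hom_closed frag_of_pair_closed)
    fix g h k assume [simp]: "g \<in> carrier G" "h \<in> carrier G" "k \<in> carrier G"
    let ?x = "frag_of (h, k) \<otimes>\<^bsub>bar_chain2 G\<^esub> frag_of (g, h \<otimes> k)"
    let ?y = "frag_of (g \<otimes> h, k) \<otimes>\<^bsub>bar_chain2 G\<^esub> frag_of (g, h)"
    have xy: "?x \<in> carrier (bar_chain2 G)" "?y \<in> carrier (bar_chain2 G)"
      by (intro C.m_closed frag_of_pair_closed; simp)+
    have "?x = bar_boundary3 G (frag_of (g, h, k)) \<otimes>\<^bsub>bar_chain2 G\<^esub> ?y"
      by (simp add: bar_boundary3_def bar_chain2_def)
    moreover have "frag_of (g, h, k) \<in> carrier (bar_chain3 G)" by (simp add: bar_chain3_def)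
    ultimately have "?x \<in> bar_boundaries #>\<^bsub>bar_chain2 G\<^esub> ?y" unfolding r_coset_def by blast
    then have "bar_boundaries #>\<^bsub>bar_chain2 G\<^esub> ?x = bar_boundaries #>\<^bsub>bar_chain2 G\<^esub> ?y"
      using B.coset_eq_iff xy by blast
    then show "bar_cocycle h k \<otimes>\<^bsub>bar_chain2 G Mod bar_boundaries\<^esub> bar_cocycle g (h \<otimes> k)
        = bar_cocycle (g \<otimes> h) k \<otimes>\<^bsub>bar_chain2 G Mod bar_boundaries\<^esub> bar_cocycle g h"
      using q.hom_mult frag_of_pair_closed by (simp del: mult_FactGroup)
  qed
qed

lemma carrier_schur_multiplier:
  "carrier (schur_multiplier G) = (\<lambda>z. bar_boundaries #>\<^bsub>bar_chain2 G\<^esub> z) ` {z \<in> carrier (bar_chain2 G). bar_boundary2 G z = 0}"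
  by (auto simp: schur_multiplier_def carrier_FactGroup kernel_def bar_chain1_def)

text \<open>In the abelianisation of the extension, \<open>[g|h]\<close> equals \<open>s g \<cdot> s h \<cdot> s (gh)\<^sup>-\<^sup>1\<close>, where \<open>s\<close> is induced by the
  section \<open>g \<mapsto> (1, g)\<close>. So the homomorphism induced by the inclusion of 2-chains agrees on generators, and then
  everywhere, with the composition of the boundary and the homomorphism \<open>\<chi>\<close> that sends \<open>[g]\<close> to \<open>s g\<close>.
  It vanishes on cycles.\<close>

lemma cycle_in_derived:
  assumes z: "z \<in> carrier (bar_chain2 G)" "bar_boundary2 G z = 0"
  defines "A \<equiv> bar_chain2 G Mod bar_boundaries"
  shows "two_cocycle.incl A G bar_cocycle (bar_boundaries #>\<^bsub>bar_chain2 G\<^esub> z)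
    \<in> lower_central (cocycle_extension A G bar_cocycle) (Suc 0)"
proof -
  interpret C: comm_group "bar_chain2 G" by (rule comm_group_bar_chain2)
  interpret B: normal bar_boundaries "bar_chain2 G"
    using C.subgroup_imp_normal subgroup_bar_boundaries by blast
  interpret T: two_cocycle A G bar_cocycle unfolding A_def by (rule two_cocycle_bar)
  let ?E = "cocycle_extension A G bar_cocycle"
  interpret E: group ?E by (rule T.group_extension)
  define D where "D = lower_central ?E (Suc 0)"
  interpret D: normal D ?E unfolding D_def by (rule E.lower_central_normal)
  interpret q: group_hom ?E "?E Mod D" "(#>\<^bsub>?E\<^esub>) D" by (rule D.group_hom_quotient)
  interpret ab: comm_group "?E Mod D"
    unfolding D_def lower_central_1 by (rule E.derived_quot_is_comm_group)
  define s where "s g = D #>\<^bsub>?E\<^esub> (\<one>\<^bsub>A\<^esub>, g)" for g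
  have sc: "s g \<in> carrier (?E Mod D)" if "g \<in> carrier G" for g
    unfolding s_def using that by (intro q.hom_closed) (simp add: T.extension_simps)
  obtain \<chi> where \<chi>: "\<chi> \<in> hom (bar_chain1 G) (?E Mod D)" "\<And>g. g \<in> carrier G \<Longrightarrow> \<chi> (frag_of g) = s g"
    unfolding bar_chain1_def using ab.free_Abelian_group_universal[of s "carrier G"] sc by blast
  interpret \<chi>: group_hom "bar_chain1 G" "?E Mod D" \<chi>
    using \<chi>(1) by (simp add: group_hom_def group_hom_axioms_def bar_chain1_def)
  let ?\<phi> = "\<lambda>z. D #>\<^bsub>?E\<^esub> T.incl (bar_boundaries #>\<^bsub>bar_chain2 G\<^esub> z)"
  have \<phi>: "?\<phi> \<in> hom (bar_chain2 G) (?E Mod D)"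
  proof -
    have "T.incl \<circ> (#>\<^bsub>bar_chain2 G\<^esub>) bar_boundaries \<in> hom (bar_chain2 G) ?E"
      using B.r_coset_hom_Mod T.incl_hom unfolding A_def by (rule Group.hom_compose)
    from Group.hom_compose[OF this q.homh] show ?thesis by (simp add: comp_def)
  qed
  have \<psi>: "\<chi> \<circ> bar_boundary2 G \<in> hom (bar_chain2 G) (?E Mod D)"
    using bar_boundary2_hom \<chi>(1) by (rule Group.hom_compose)
  have "?\<phi> z = (\<chi> \<circ> bar_boundary2 G) z"
  proof (rule hom_free_Abelian_group_eqI)
    show "group (?E Mod D)" by (rule q.H.is_group)
    show "?\<phi> \<in> hom (free_Abelian_group (carrier G \<times> carrier G)) (?E Mod D)"
      "\<chi> \<circ> bar_boundary2 G \<in> hom (free_Abelian_group (carrier G \<times> carrier G)) (?E Mod D)"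
      using \<phi> \<psi> unfolding bar_chain2_def by auto
    show "Poly_Mapping.keys z \<subseteq> carrier G \<times> carrier G" using z(1) by (simp add: bar_chain2_def)
    fix x assume "x \<in> carrier G \<times> carrier G"
    then obtain g h where x: "x = (g, h)" and gh [simp]: "g \<in> carrier G" "h \<in> carrier G" by auto
    have mem: "(\<one>\<^bsub>A\<^esub>, g) \<in> carrier ?E" "(\<one>\<^bsub>A\<^esub>, h) \<in> carrier ?E" "(\<one>\<^bsub>A\<^esub>, g \<otimes> h) \<in> carrier ?E"
        "T.incl (bar_cocycle g h) \<in> carrier ?E"
      using T.incl_closed[OF T.f_closed[OF gh]] by (simp_all add: T.extension_simps)
    have mul: "s g \<otimes>\<^bsub>?E Mod D\<^esub> s h = ?\<phi> (frag_of x) \<otimes>\<^bsub>?E Mod D\<^esub> s (g \<otimes> h)"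
      unfolding s_def x using q.hom_mult[OF mem(1,2)] q.hom_mult[OF mem(4,3)] T.section_mult[OF gh] by metis
    have \<phi>c: "?\<phi> (frag_of x) \<in> carrier (?E Mod D)" unfolding x using mem(4) by (rule q.hom_closed)
    have 1: "?\<phi> (frag_of x) = s g \<otimes>\<^bsub>?E Mod D\<^esub> s h \<otimes>\<^bsub>?E Mod D\<^esub> inv\<^bsub>?E Mod D\<^esub> s (g \<otimes> h)"
      by (rule q.H.inv_solve_right[THEN iffD2, OF \<phi>c q.H.m_closed[OF sc[OF gh(1)] sc[OF gh(2)]] sc[OF m_closed[OF gh]] mul])
    have fr: "frag_of g \<in> carrier (bar_chain1 G)" "frag_of h \<in> carrier (bar_chain1 G)" "frag_of (g \<otimes> h) \<in> carrier (bar_chain1 G)"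
      by (simp_all add: bar_chain1_def)
    have "bar_boundary2 G (frag_of x) = frag_of g \<otimes>\<^bsub>bar_chain1 G\<^esub> frag_of h \<otimes>\<^bsub>bar_chain1 G\<^esub> inv\<^bsub>bar_chain1 G\<^esub> frag_of (g \<otimes> h)"
      by (simp add: x bar_boundary2_def bar_chain1_def)
    then have "\<chi> (bar_boundary2 G (frag_of x)) = s g \<otimes>\<^bsub>?E Mod D\<^esub> s h \<otimes>\<^bsub>?E Mod D\<^esub> inv\<^bsub>?E Mod D\<^esub> s (g \<otimes> h)"
      using fr \<chi>(2) by (simp del: mult_FactGroup)
    then show "?\<phi> (frag_of x) = (\<chi> \<circ> bar_boundary2 G) (frag_of x)" using 1 by (simp del: mult_FactGroup)
  qed
  also have "\<dots> = \<one>\<^bsub>?E Mod D\<^esub>" using z(2) \<chi>.hom_one by (simp add: bar_chain1_def del: one_FactGroup)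
  finally have "?\<phi> z = D" by simp
  moreover have "bar_boundaries #>\<^bsub>bar_chain2 G\<^esub> z \<in> carrier A"
    unfolding A_def carrier_FactGroup using z(1) by blast
  ultimately show ?thesis using D.coset_eq_self_iff T.incl_closed unfolding D_def by blast
qed

end

section \<open>The bound for the Schur multiplier\<close>

text \<open>The top layer is bounded through its square, so the comparison is made between squares, with all
  negative exponents moved to the other side.\<close>

lemma le_powr_if_exponents:
  fixes p M N n k d e s :: nat
  assumes p: "1 < p" and d: "1 \<le> d"
    and M: "M * p ^ k \<le> N * p ^ e"
    and N: "N\<^sup>2 * p ^ (k * (d - 1)) \<le> p ^ (n * (d - 1))"
    and e: "e + s = d * k"
  shows "real M \<le> real p powr ((real d - 1) * (real n + real k) / 2 - real s)"
proof -
  define x where "x = (real d - 1) * (real n + real k) / 2 - real s"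
  define y where "y = 2 * k + k * (d - 1) + 2 * s"
  have "M\<^sup>2 * p ^ y = (M * p ^ k)\<^sup>2 * p ^ (k * (d - 1)) * p ^ (2 * s)"
    by (simp add: y_def power_add power_mult_distrib mult.assoc flip: power_mult) (simp add: mult.commute)
  also have "\<dots> \<le> (N * p ^ e)\<^sup>2 * p ^ (k * (d - 1)) * p ^ (2 * s)"
    using M by (intro mult_le_mono1 power_mono) auto
  also have "\<dots> = (N\<^sup>2 * p ^ (k * (d - 1))) * p ^ (2 * (e + s))"
    by (simp add: power_add power_mult_distrib algebra_simps flip: power_mult)
  also have "\<dots> \<le> p ^ (n * (d - 1)) * p ^ (2 * (d * k))"
    unfolding e using N by (rule mult_le_mono1)
  finally have "M\<^sup>2 * p ^ y \<le> p ^ (n * (d - 1) + 2 * (d * k))" by (simp add: power_add)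
  then have "real (M\<^sup>2 * p ^ y) \<le> real (p ^ (n * (d - 1) + 2 * (d * k)))" by (simp only: of_nat_le_iff)
  then have "(real M)\<^sup>2 * real p ^ y \<le> real p ^ (n * (d - 1) + 2 * (d * k))"
    by (simp only: of_nat_mult of_nat_power)
  moreover have p0: "0 < real p" using p by simp
  ultimately have "(real M)\<^sup>2 * real p powr real y \<le> real p powr real (n * (d - 1) + 2 * (d * k))"
    by (simp only: powr_realpow[OF p0])
  moreover have "real (n * (d - 1) + 2 * (d * k)) = 2 * x + real y"
    using d by (simp add: x_def y_def of_nat_diff field_simps)
  ultimately have "(real M)\<^sup>2 * real p powr real y \<le> real p powr (2 * x) * real p powr real y"
    by (simp only: powr_add)
  then have "(real M)\<^sup>2 \<le> real p powr (2 * x)" using p by simp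
  also have "\<dots> = (real p powr x)\<^sup>2" by (simp add: power2_eq_square flip: powr_add)
  finally show ?thesis unfolding x_def by (rule power2_le_imp_le) simp
qed

theorem theorem1p1:
  fixes G :: "('a, 'b) monoid_scheme" and p n c k d :: nat
  assumes "Factorial_Ring.prime p"
    and "group G"
    and "\<not> comm_group G"
    and "order G = p ^ n"
    and "has_nilpotency_class G c"
    and "card (derived G (carrier G)) = p ^ k"
    and "min_generators G = d"
  shows "finite (carrier (schur_multiplier G)) \<and>
    real (order (schur_multiplier G))
      \<le> real p powr ((real d - 1) * (real n + real k) / 2 - (\<Sum>i = 2..min d c. real d - real i))"
proof -
  interpret group G by (rule assms(2))
  have p: "1 < p" using assms(1) prime_gt_1_nat by blast
  have fin: "finite (carrier G)"
    using assms(4) p order_gt_0_iff_finite by simp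
  have nontrivial: "carrier G \<noteq> {\<one>\<^bsub>G\<^esub>}"
  proof
    assume "carrier G = {\<one>\<^bsub>G\<^esub>}"
    then have "comm_group G" by (intro group_comm_groupI) auto
    then show False using assms(3) by blast
  qed
  have c: "1 \<le> c"
    using assms(5) nontrivial by (cases c) (auto simp: has_nilpotency_class_def)
  have "\<exists>S\<subseteq>carrier G. finite S \<and> card S = card (carrier G) \<and> generate G S = carrier G"
    using fin generateI[OF subgroup_self order_refl] by auto
  then have "\<exists>S\<subseteq>carrier G. finite S \<and> card S = d \<and> generate G S = carrier G"
    unfolding assms(7)[symmetric] min_generators_def by (rule LeastI)
  then obtain S where S: "S \<subseteq> carrier G" "finite S" "card S = d" "generate G S = carrier G" by blast
  have d: "1 \<le> d"
  proof (rule ccontr)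
    assume "\<not> 1 \<le> d"
    then have "card S = 0" using S(3) by simp
    then have "S = {}" using S(2) by simp
    then show False
      using S(4) nontrivial generate_subgroup_incl[OF empty_subsetI triv_subgroup] by auto
  qed
  define A where "A = bar_chain2 G Mod bar_boundaries"
  interpret T: two_cocycle A G bar_cocycle unfolding A_def by (rule two_cocycle_bar)
  interpret X: central_extension T.E G snd using fin by (rule T.central_extension)
  let ?S = "(\<lambda>g. (\<one>\<^bsub>A\<^esub>, g)) ` S"
  have "inj_on (\<lambda>g. (\<one>\<^bsub>A\<^esub>, g)) S" by (rule inj_onI) simp
  then have S': "finite ?S" "card ?S = d" using S(2,3) by (simp_all add: card_image)
  have S'': "?S \<subseteq> carrier T.E" using S(1) by (auto simp: T.extension_simps)
  have "snd ` ?S = S" by (simp add: image_image)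
  then have gen: "generate G (snd ` ?S) = carrier G" using S(4) by simp
  have k: "card (lower_central G (Suc 0)) = p ^ k" using assms(6) by (simp add: lower_central_1)
  obtain N e where Ne: "finite (lower_central T.E (Suc 0))" "card (lower_central T.E (Suc 0)) \<le> N * p ^ e"
      "N\<^sup>2 * p ^ (k * (d - 1)) \<le> p ^ (n * (d - 1))"
      "e + (\<Sum>i = 2..min d c. d - i) = d * k"
    using X.card_derived_le[OF assms(1,4) S'(1) S'' gen assms(5) c k] unfolding S'(2) by blast
  let ?M = "T.incl ` carrier (schur_multiplier G)"
  have sub: "carrier (schur_multiplier G) \<subseteq> carrier A"
    unfolding carrier_schur_multiplier A_def carrier_FactGroup by blast
  have M: "?M \<subseteq> lower_central T.E (Suc 0)"
    unfolding carrier_schur_multiplier A_def using cycle_in_derived by blast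
  have inj: "inj_on T.incl (carrier (schur_multiplier G))"
    using T.inj_incl sub by (rule inj_on_subset)
  have finM: "finite (carrier (schur_multiplier G))"
    using finite_subset[OF M Ne(1)] inj by (rule finite_imageD)
  have "card ?M * card (lower_central G (Suc 0)) \<le> card (lower_central T.E (Suc 0))"
    using Ne(1) M by (rule X.card_central_mult_card_derived_le) (auto simp: T.incl_def)
  then have "order (schur_multiplier G) * p ^ k \<le> N * p ^ e"
    using Ne(2) inj by (simp add: k order_def card_image)
  then have "real (order (schur_multiplier G))
      \<le> real p powr ((real d - 1) * (real n + real k) / 2 - real (\<Sum>i = 2..min d c. d - i))"
    using p d Ne(3,4) by (intro le_powr_if_exponents)
  also have "real (\<Sum>i = 2..min d c. d - i) = (\<Sum>i = 2..min d c. real d - real i)"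
    unfolding of_nat_sum by (rule sum.cong) (auto simp: of_nat_diff)
  finally show ?thesis using finM by blast
qed

end
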